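(* Let $G=(V,E)$ be a finite decomposable graph and let $C\in\mathcal C_G$ be a clique of $G$. 1) If $r>0$, $x\in M_G$ and $N\sim \operatorname{nm}_G(r,x)$, then $N_C=(N_i)_{i\in C}$ has the distribution $\operatorname{nm}_{K_C}(r,x^C)$, where $$x^C_i=x_i\,\frac{\Delta_{\mathfrak{nb}_{G^*}(i)}(x)}{\Delta_{V\setminus C}(x)},\qquad i\in C.$$ 2) If $r\in\{1,2,\ldots\}$, $y\in(0,\infty)^V$ and $N\sim \operatorname{mult}_G(r,y)$, then $N_C=(N_i)_{i\in C}$ has the distribution $\operatorname{mult}_{K_C}(r,y^C)$, where $$y^C_i=y_i\,\frac{\delta_{\mathfrak{nb}_{G^*}(i)}(y)}{\delta_{V\setminus C}(y)},\qquad i\in C.$$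
   Context: $\mathbb N=\{0,1,2,\ldots\}$. $G=(V,E)$ is a finite undirected simple graph; $G^*$ is its complement graph; $G_A$ is the subgraph induced by $A\subset V$; $K_C$ is the complete graph on $C$. A clique is a set of pairwise adjacent vertices ($\emptyset$ and singletons are cliques); $\mathcal C_G$ is the set of cliques of $G$ and $\mathcal C_G^+$ the set of maximal cliques. $\mathfrak{nb}_{G^*}(i)$ is the set of neighbours of $i$ in $G^*$, i.e. the vertices $j\neq i$ not adjacent to $i$ in $G$. $G$ is decomposable iff it is chordal (no induced cycle of length greater than 3). Polynomials: $\Delta_G(x)=\sum_{C\in\mathcal C_{G^*}}(-1)^{|C|}\prod_{i\in C}x_i$ and $\delta_G(y)=\sum_{C\in\mathcal C_{G^*}}\prod_{i\in C}y_i$. For $A\subset V$, $\Delta_A(x):=\Delta_{G_A}(x_A)$, $\delta_A(y):=\delta_{G_A}(y_A)$, where $x_A=(x_i)_{i\in A}$; $\Delta_\emptyset=\delta_\emptyset=1$. $M_G=\{x\in(0,\infty)^V:\ \Delta_A(x)>0\ \text{for all } A\subset V\}$. Graph-multinomial coefficients: for an integer $r\ge1$, $\binom{r}{n}_G$ is defined by $\delta_G(y)^r=\sum_{n\in\mathbb N^V}\binom{r}{n}_G y^n$; for real $r>0$, $\genfrac{[}{]}{0pt}{}{|n|+r-1}{n}_G$ is defined by the formal power series expansion $\Delta_G(x)^{-r}=\sum_{n\in\mathbb N^V}\genfrac{[}{]}{0pt}{}{|n|+r-1}{n}_G x^n$. Here $x^n=\prod_{i\in V}x_i^{n_i}$ and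 $|n_A|=\sum_{i\in A}n_i$, $|n|=|n_V|$. $N\sim\operatorname{nm}_G(r,x)$ ($r>0$, $x\in M_G$) means $\mathbb P(N=n)=\genfrac{[}{]}{0pt}{}{|n|+r-1}{n}_G\,x^n\Delta_G(x)^r$ for $n\in\mathbb N^V$. $N\sim\operatorname{mult}_G(r,y)$ ($r\in\{1,2,\ldots\}$, $y\in(0,\infty)^V$) means $\mathbb P(N=n)=\binom{r}{n}_G\,y^n\delta_G(y)^{-r}$ for $n\in\mathbb N_{G,r}:=\{n\in\mathbb N^V:\max_{C\in\mathcal C_G^+}|n_C|\le r\}$. For the complete graph $K_C$ these are the usual negative multinomial distribution, $\mathbb P(N_C=n)=\frac{\Gamma(|n|+r)}{\Gamma(r)\prod_{i\in C} n_i!}x^n(1-\sum_{i\in C}x_i)^r$, $n\in\mathbb N^C$, and the usual multinomial distribution, $\mathbb P(N_C=n)=\frac{r!}{(r-|n|)!\prod_{i\in C} n_i!}y^n(1+\sum_{i\in C}y_i)^{-r}$, $n\in\mathbb N^C$, $|n|\le r$ (for $C=\emptyset$, the point mass). *)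

theory Defs
  imports "HOL-Probability.Probability" "HOL-Library.Poly_Mapping"
begin

section \<open>Finite simple graphs\<close>

type_synonym 'a graph = "'a set \<times> 'a set set"

abbreviation verts :: "'a graph \<Rightarrow> 'a set" where
  "verts G \<equiv> fst G"

abbreviation edges :: "'a graph \<Rightarrow> 'a set set" where
  "edges G \<equiv> snd G"

definition simple_graph :: "'a graph \<Rightarrow> bool" where
  "simple_graph G \<longleftrightarrow> finite (verts G) \<and> (\<forall>e\<in>edges G. e \<subseteq> verts G \<and> card e = 2)"

definition complete_graph :: "'a set \<Rightarrow> 'a graph" where
  "complete_graph A = (A, {e. e \<subseteq> A \<and> card e = 2})"

definition complement_graph :: "'a graph \<Rightarrow> 'a graph" where
  "complement_graph G = (verts G, edges (complete_graph (verts G)) - edges G)"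

definition induced_subgraph :: "'a graph \<Rightarrow> 'a set \<Rightarrow> 'a graph" where
  "induced_subgraph G A = (A, {e \<in> edges G. e \<subseteq> A})"

definition neighbours :: "'a graph \<Rightarrow> 'a \<Rightarrow> 'a set" where
  "neighbours G i = {j. j \<noteq> i \<and> {i, j} \<in> edges G}"

definition cliques :: "'a graph \<Rightarrow> 'a set set" where
  "cliques G = {C. C \<subseteq> verts G \<and> (\<forall>i\<in>C. \<forall>j\<in>C. i \<noteq> j \<longrightarrow> {i, j} \<in> edges G)}"

definition maximal_cliques :: "'a graph \<Rightarrow> 'a set set" where
  "maximal_cliques G = {C \<in> cliques G. \<forall>D\<in>cliques G. C \<subseteq> D \<longrightarrow> D = C}"

definition induced_cycle :: "'a graph \<Rightarrow> 'a list \<Rightarrow> bool" where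
  "induced_cycle G cs \<longleftrightarrow> 3 \<le> length cs \<and> distinct cs \<and> set cs \<subseteq> verts G \<and>
     (\<forall>i<length cs. \<forall>j<length cs. {cs ! i, cs ! j} \<in> edges G \<longleftrightarrow>
        j = Suc i mod length cs \<or> i = Suc j mod length cs)"

definition decomposable :: "'a graph \<Rightarrow> bool" where
  "decomposable G \<longleftrightarrow> (\<forall>cs. induced_cycle G cs \<longrightarrow> length cs \<le> 3)"


section \<open>The clique polynomials of the complement graph\<close>

text \<open>
  Both are polymorphic in the ring of arguments, so that one definition gives the real values
  (at a vector \<open>x :: 'a \<Rightarrow> real\<close>, of which only the coordinates in \<open>verts G\<close> matter) and the
  formal polynomials (at the indeterminates \<open>indet\<close> below).
\<close>

definition Delta :: "'a graph \<Rightarrow> ('a \<Rightarrow> 'r) \<Rightarrow> 'r::comm_ring_1" where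
  "Delta G x = (\<Sum>C\<in>cliques (complement_graph G). (-1) ^ card C * (\<Prod>i\<in>C. x i))"

definition delta :: "'a graph \<Rightarrow> ('a \<Rightarrow> 'r) \<Rightarrow> 'r::comm_semiring_1" where
  "delta G y = (\<Sum>C\<in>cliques (complement_graph G). \<Prod>i\<in>C. y i)"

definition Delta_sub :: "'a graph \<Rightarrow> 'a set \<Rightarrow> ('a \<Rightarrow> 'r) \<Rightarrow> 'r::comm_ring_1" where
  "Delta_sub G A x = Delta (induced_subgraph G A) x"

definition delta_sub :: "'a graph \<Rightarrow> 'a set \<Rightarrow> ('a \<Rightarrow> 'r) \<Rightarrow> 'r::comm_semiring_1" where
  "delta_sub G A y = delta (induced_subgraph G A) y"

definition M_set :: "'a graph \<Rightarrow> ('a \<Rightarrow> real) set" where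
  "M_set G = {x. (\<forall>i\<in>verts G. 0 < x i) \<and> (\<forall>A\<subseteq>verts G. 0 < Delta_sub G A x)}"


section \<open>Graph multinomial coefficients\<close>

text \<open>A polynomial maps exponent vectors \<open>'a \<Rightarrow>\<^sub>0 nat\<close> to coefficients.\<close>

type_synonym 'a real_mpoly = "('a \<Rightarrow>\<^sub>0 nat) \<Rightarrow>\<^sub>0 real"

definition indet :: "'a \<Rightarrow> 'a real_mpoly" where
  "indet i = Poly_Mapping.single (Poly_Mapping.single i 1) 1"

definition exponent :: "'a set \<Rightarrow> ('a \<Rightarrow> nat) \<Rightarrow> ('a \<Rightarrow>\<^sub>0 nat)" where
  "exponent V n = (\<Sum>i\<in>V. Poly_Mapping.single i (n i))"

definition mult_coeff :: "'a graph \<Rightarrow> nat \<Rightarrow> ('a \<Rightarrow> nat) \<Rightarrow> real" where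
  "mult_coeff G r n = Poly_Mapping.lookup (delta G indet ^ r) (exponent (verts G) n)"

text \<open>
  As \<open>Delta G\<close> has constant term \<open>1\<close>, its real power \<open>-r\<close> as a formal power series is the
  binomial series \<open>\<Sum>k. (- r gchoose k) * (Delta G - 1) ^ k\<close>. The \<open>k\<close>-th summand only has
  monomials of total degree at least \<open>k\<close> (see \<open>Delta_minus_1_power_degree\<close>), so the coefficient
  of \<open>x\<^sup>n\<close> is the finite sum below.
\<close>

definition nm_coeff :: "'a graph \<Rightarrow> real \<Rightarrow> ('a \<Rightarrow> nat) \<Rightarrow> real" where
  "nm_coeff G r n = (\<Sum>k\<le>(\<Sum>i\<in>verts G. n i).
     (- r gchoose k) * Poly_Mapping.lookup ((Delta G indet - 1) ^ k) (exponent (verts G) n))"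

lemma lookup_exponent:
  "finite V \<Longrightarrow> Poly_Mapping.lookup (exponent V n) i = (if i \<in> V then n i else 0)"
  by (simp add: exponent_def lookup_sum lookup_single when_def)

lemma prod_indet:
  "finite C \<Longrightarrow> (\<Prod>i\<in>C. indet i) = Poly_Mapping.single (exponent C (\<lambda>_. 1)) 1"
proof (induction C rule: finite_induct)
  case empty
  show ?case by (simp add: exponent_def)
next
  case (insert i C)
  then show ?case by (simp add: exponent_def indet_def mult_single)
qed

lemma Delta_minus_1_degree:
  assumes "finite (verts G)" and "m \<in> Poly_Mapping.keys (Delta G indet - 1)"
  shows "1 \<le> (\<Sum>i\<in>verts G. Poly_Mapping.lookup m i)"
proof -
  let ?K = "cliques (complement_graph G)"
  have sub: "C \<subseteq> verts G" if "C \<in> ?K" for C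
    using that by (auto simp: cliques_def complement_graph_def)
  have "finite ?K"
    using sub assms(1) by (meson finite_Pow_iff finite_subset PowI subsetI)
  moreover have "{} \<in> ?K"
    by (simp add: cliques_def)
  ultimately have "Delta G indet - 1 = (\<Sum>C\<in>?K - {{}}. (-1) ^ card C * (\<Prod>i\<in>C. indet i))"
    by (simp add: Delta_def sum.remove[of ?K "{}"])
  then have "m \<in> (\<Union>C\<in>?K - {{}}. Poly_Mapping.keys ((-1) ^ card C * (\<Prod>i\<in>C. indet i :: 'a real_mpoly)))"
    using assms(2) keys_sum by fastforce
  then obtain C where C: "C \<in> ?K" "C \<noteq> {}"
    and m: "m \<in> Poly_Mapping.keys ((-1) ^ card C * (\<Prod>i\<in>C. indet i :: 'a real_mpoly))"
    by blast
  have fin: "finite C"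
    using C sub assms(1) finite_subset by blast
  have "Poly_Mapping.keys ((-1) ^ card C * p) = Poly_Mapping.keys p" for p :: "'a real_mpoly"
    by (cases "even (card C)") simp_all
  then have "m = exponent C (\<lambda>_. 1)"
    using m fin by (simp add: prod_indet)
  moreover obtain i where "i \<in> C" using C by blast
  ultimately have "i \<in> verts G" "Poly_Mapping.lookup m i = 1"
    using fin sub C by (auto simp: lookup_exponent)
  then show ?thesis
    using assms(1) by (metis member_le_sum zero_le)
qed

lemma Delta_minus_1_power_degree:
  assumes "finite (verts G)" and "m \<in> Poly_Mapping.keys ((Delta G indet - 1) ^ k)"
  shows "k \<le> (\<Sum>i\<in>verts G. Poly_Mapping.lookup m i)"
  using assms(2)
proof (induction k arbitrary: m)
  case (Suc k)
  then have "m \<in> Poly_Mapping.keys ((Delta G indet - 1) * (Delta G indet - 1) ^ k)"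
    by simp
  then obtain a b where "m = a + b" "a \<in> Poly_Mapping.keys (Delta G indet - 1)"
    "b \<in> Poly_Mapping.keys ((Delta G indet - 1) ^ k)"
    using keys_mult by blast
  then show ?case
    using Delta_minus_1_degree[OF assms(1)] Suc.IH
    by (fastforce simp: lookup_add sum.distrib)
qed simp


section \<open>Graph multinomial distributions\<close>

text \<open>
  Elements of \<open>\<nat>\<^sup>V\<close> are the extensional functions in \<open>V \<rightarrow>\<^sub>E UNIV\<close>, so that the subvector
  indexed by \<open>C\<close> of \<open>N\<close> is \<open>\<lambda>\<omega>. restrict (N \<omega>) C\<close>. The admissibility of the
  parameters is part of both predicates.
\<close>

definition nm_distributed ::
  "'w measure \<Rightarrow> ('w \<Rightarrow> 'a \<Rightarrow> nat) \<Rightarrow> 'a graph \<Rightarrow> real \<Rightarrow> ('a \<Rightarrow> real) \<Rightarrow> bool" where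
  "nm_distributed M N G r x \<longleftrightarrow>
     0 < r \<and> x \<in> M_set G \<and>
     N \<in> measurable M (count_space (verts G \<rightarrow>\<^sub>E UNIV)) \<and>
     (\<forall>n\<in>verts G \<rightarrow>\<^sub>E UNIV.
        measure M {\<omega> \<in> space M. N \<omega> = n} =
          nm_coeff G r n * (\<Prod>i\<in>verts G. x i ^ n i) * Delta G x powr r)"

definition mult_support :: "'a graph \<Rightarrow> nat \<Rightarrow> ('a \<Rightarrow> nat) set" where
  "mult_support G r =
     {n \<in> verts G \<rightarrow>\<^sub>E UNIV. Max ((\<lambda>C. \<Sum>i\<in>C. n i) ` maximal_cliques G) \<le> r}"

text \<open>
  The probabilities below sum to \<open>1\<close> over \<open>mult_support G r\<close>, hence \<open>N\<close> almost surely lies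
  in this set.
\<close>

definition mult_distributed ::
  "'w measure \<Rightarrow> ('w \<Rightarrow> 'a \<Rightarrow> nat) \<Rightarrow> 'a graph \<Rightarrow> nat \<Rightarrow> ('a \<Rightarrow> real) \<Rightarrow> bool" where
  "mult_distributed M N G r y \<longleftrightarrow>
     1 \<le> r \<and> (\<forall>i\<in>verts G. 0 < y i) \<and>
     N \<in> measurable M (count_space (verts G \<rightarrow>\<^sub>E UNIV)) \<and>
     (\<forall>n\<in>mult_support G r.
        measure M {\<omega> \<in> space M. N \<omega> = n} =
          mult_coeff G r n * (\<Prod>i\<in>verts G. y i ^ n i) / delta G y ^ r)"

end

theory Submission
  imports Defs
begin

text \<open>
  The cliques of the complement graph are the independent sets of \<open>G\<close>, and an independent set
  meets the clique \<open>C\<close> in at most one vertex. Sorting the independent sets by this vertex shows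
  that \<open>Delta G\<close> and \<open>delta G\<close> are affine in the variables of \<open>C\<close>
  (\<open>delta_clique_split\<close>): up to the factor \<open>Delta_sub G (verts G - C) x\<close> or
  \<open>delta_sub G (verts G - C) y\<close>, they are the polynomials of the complete graph on \<open>C\<close> with the
  parameters \<open>x\<^sup>C\<close> and \<open>y\<^sup>C\<close>. The mass of a marginal event \<open>N\<^sub>C \<in> Y\<close> is a sum of terms
  of a power of the polynomial over a cylinder, and it remains to see that taking the power
  commutes with summing over cylinders. The lemma \<open>has_sum_independent_convolution\<close> does this
  for one factor \<open>delta G\<close>.

  For the multinomial distribution this suffices, by induction on the integer exponent
  (\<open>mult_cylinder_sum\<close>). The case of the empty clique gives the total mass, from which it follows
  that \<open>N\<close> almost surely lies in \<open>mult_support G r\<close> (\<open>mult_pmf\<close>).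

  For the negative multinomial distribution the exponent is real. There the power
  \<open>A = P\<^sup>-\<^sup>r\<close> of \<open>P = Delta G\<close> is characterised by the formal differential equation
  \<open>P \<cdot> E A = - r \<cdot> E P \<cdot> A\<close>, where \<open>E\<close> is Euler's operator in the variables of \<open>C\<close>. This is a
  recurrence with finitely many terms (\<open>nm_coeff_recurrence\<close>). Summed over cylinders it becomes
  a recurrence for the marginal law \<open>\<beta>\<close> of \<open>N\<^sub>C\<close>: if all points of \<open>Y\<close> have degree \<open>k\<close>, then
  \<open>k \<beta>(Y) = (k - 1 + r) (\<Sum>j\<in>C. x\<^sup>C\<^sub>j \<beta>(Y - e\<^sub>j))\<close>. The weights of the complete graph satisfy the
  same recurrence, and its solutions are proportional (\<open>level_recurrence_unique\<close>). The factor
  is found by summing over all degrees with the binomial series. As the terms of all infinite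
  sums are probabilities up to a constant, convergence is countable additivity.
\<close>

section \<open>Independent sets and cliques\<close>

lemma independent_iff:
  "S \<in> cliques (complement_graph G) \<longleftrightarrow>
    S \<subseteq> verts G \<and> (\<forall>i\<in>S. \<forall>j\<in>S. i \<noteq> j \<longrightarrow> {i, j} \<notin> edges G)"
  by (auto simp: cliques_def complement_graph_def complete_graph_def)

lemma finite_independent: "finite (verts G) \<Longrightarrow> finite (cliques (complement_graph G))"
  by (rule finite_subset[of _ "Pow (verts G)"]) (auto simp: independent_iff)

lemma independent_induced:
  "A \<subseteq> verts G \<Longrightarrow>
    cliques (complement_graph (induced_subgraph G A)) = {S \<in> cliques (complement_graph G). S \<subseteq> A}"
  by (fastforce simp: independent_iff induced_subgraph_def)

lemma independent_complete:
  "cliques (complement_graph (complete_graph A)) = insert {} ((\<lambda>i. {i}) ` A)"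
proof -
  have "S = {} \<or> (\<exists>i\<in>A. S = {i})" if "S \<in> cliques (complement_graph (complete_graph A))" for S
  proof (cases "S = {}")
    case False
    then obtain i where "i \<in> S" by blast
    then have "S = {i}" "i \<in> A"
      using that by (auto simp: independent_iff complete_graph_def)
    then show ?thesis by blast
  qed simp
  moreover have "{} \<in> cliques (complement_graph (complete_graph A))"
    "i \<in> A \<Longrightarrow> {i} \<in> cliques (complement_graph (complete_graph A))" for i
    by (auto simp: independent_iff complete_graph_def)
  ultimately show ?thesis by blast
qed

lemma neighbours_complement:
  "i \<in> verts G \<Longrightarrow>
    neighbours (complement_graph G) i = {j \<in> verts G. j \<noteq> i \<and> {i, j} \<notin> edges G}"
  by (auto simp: neighbours_def complement_graph_def complete_graph_def)

text \<open>
  An independent set meets the clique \<open>C\<close> in at most one vertex. It either avoids \<open>C\<close>, or it is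
  \<open>insert j S\<close> for a unique \<open>j \<in> C\<close>, and then \<open>S\<close> consists of non-neighbours of \<open>j\<close>.
\<close>
lemma sum_independent_split:
  fixes g :: "'a set \<Rightarrow> 'b::comm_monoid_add"
  assumes fin: "finite (verts G)" and C: "C \<in> cliques G"
  shows "(\<Sum>S\<in>cliques (complement_graph G). g S) =
    (\<Sum>S\<in>{S \<in> cliques (complement_graph G). S \<subseteq> verts G - C}. g S) +
    (\<Sum>j\<in>C. \<Sum>S\<in>{S \<in> cliques (complement_graph G).
        S \<subseteq> neighbours (complement_graph G) j}. g (insert j S))"
proof -
  let ?I = "cliques (complement_graph G)"
  let ?nb = "neighbours (complement_graph G)"
  let ?J = "\<lambda>j. {S \<in> ?I. S \<subseteq> ?nb j}"
  have CV: "C \<subseteq> verts G" and cl: "\<And>i j. i \<in> C \<Longrightarrow> j \<in> C \<Longrightarrow> i \<noteq> j \<Longrightarrow> {i, j} \<in> edges G"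
    using C by (auto simp: cliques_def)
  have finC: "finite C" using CV fin finite_subset by blast
  have finI: "finite ?I" by (rule finite_independent[OF fin])
  have nb: "?nb j = {i \<in> verts G. i \<noteq> j \<and> {j, i} \<notin> edges G}" if "j \<in> C" for j
    by (rule neighbours_complement) (use that CV in blast)
  have nbC: "?nb j \<inter> C = {}" if "j \<in> C" for j
    using nb[OF that] cl[OF that] by blast
  have img: "insert j ` ?J j = {S \<in> ?I. j \<in> S}" if j: "j \<in> C" for j
  proof (intro set_eqI iffI)
    fix S assume "S \<in> insert j ` ?J j"
    then show "S \<in> {S \<in> ?I. j \<in> S}"
      using CV j by (auto simp: independent_iff nb[OF j] insert_commute)
  next
    fix S assume S: "S \<in> {S \<in> ?I. j \<in> S}"
    then have "S - {j} \<in> ?J j"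
      by (auto simp: independent_iff nb[OF j])
    then have "insert j (S - {j}) \<in> insert j ` ?J j" by (rule imageI)
    then show "S \<in> insert j ` ?J j"
      using S by (simp add: insert_absorb)
  qed
  have inj: "inj_on (insert j) (?J j)" if j: "j \<in> C" for j
    by (rule inj_onI) (use nb[OF j] in blast)
  have I: "?I = {S \<in> ?I. S \<subseteq> verts G - C} \<union> (\<Union>j\<in>C. {S \<in> ?I. j \<in> S})"
    by (auto simp: independent_iff)
  have "(\<Sum>S\<in>?I. g S) = (\<Sum>S\<in>{S \<in> ?I. S \<subseteq> verts G - C}. g S) +
      (\<Sum>S\<in>(\<Union>j\<in>C. {S \<in> ?I. j \<in> S}). g S)"
    by (subst I, rule sum.union_disjoint) (use finI finC in auto)
  also have "(\<Sum>S\<in>(\<Union>j\<in>C. {S \<in> ?I. j \<in> S}). g S) = (\<Sum>j\<in>C. \<Sum>S\<in>{S \<in> ?I. j \<in> S}. g S)"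
  proof (rule sum.UNION_disjoint)
    show "\<forall>i\<in>C. \<forall>j\<in>C. i \<noteq> j \<longrightarrow> {S \<in> ?I. i \<in> S} \<inter> {S \<in> ?I. j \<in> S} = {}"
    proof (intro ballI impI)
      fix i j assume "i \<in> C" "j \<in> C" "i \<noteq> j"
      then show "{S \<in> ?I. i \<in> S} \<inter> {S \<in> ?I. j \<in> S} = {}"
        using cl[of i j] by (simp add: independent_iff) blast
    qed
  qed (use finI finC in auto)
  also have "\<dots> = (\<Sum>j\<in>C. \<Sum>S\<in>?J j. g (insert j S))"
  proof (rule sum.cong[OF refl])
    fix j assume j: "j \<in> C"
    show "(\<Sum>S\<in>{S \<in> ?I. j \<in> S}. g S) = (\<Sum>S\<in>?J j. g (insert j S))"
      by (subst img[OF j, symmetric], subst sum.reindex[OF inj[OF j]]) simp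
  qed
  finally show ?thesis .
qed

text \<open>
  The two polynomials differ by the sign of the arguments only, which lets every fact about
  independent sets be proved for \<open>delta\<close> alone.
\<close>
lemma Delta_eq_delta: "finite (verts G) \<Longrightarrow> Delta G x = delta G (\<lambda>i. - x i)"
  unfolding Delta_def delta_def
  by (intro sum.cong refl) (simp add: prod_uminus)

lemma neighbours_complement_subset:
  assumes C: "C \<in> cliques G" and j: "j \<in> C"
  shows "neighbours (complement_graph G) j \<subseteq> verts G - C"
proof
  fix i assume i: "i \<in> neighbours (complement_graph G) j"
  have "j \<in> verts G" using C j by (auto simp: cliques_def)
  then have "i \<in> verts G" "j \<noteq> i" "{j, i} \<notin> edges G"
    using i by (auto simp: neighbours_complement)
  then show "i \<in> verts G - C"
    using C j by (auto simp: cliques_def)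
qed

lemma delta_sub_verts: "simple_graph G \<Longrightarrow> delta_sub G (verts G) y = delta G y"
  by (simp add: delta_sub_def delta_def independent_induced) (auto simp: independent_iff intro!: sum.cong)

text \<open>
  The polynomial is affine in the variables of a clique. The summands over \<open>j\<close>,
  divided by the constant term, are the parameters of the marginal distribution.
\<close>
lemma delta_clique_split:
  fixes y :: "'a \<Rightarrow> 'r::comm_ring_1"
  assumes G: "simple_graph G" and C: "C \<in> cliques G"
  shows "delta G y = delta_sub G (verts G - C) y +
    (\<Sum>j\<in>C. y j * delta_sub G (neighbours (complement_graph G) j) y)"
proof -
  let ?nb = "neighbours (complement_graph G)"
  have fin: "finite (verts G)" using G by (simp add: simple_graph_def)
  have nb: "?nb j \<subseteq> verts G - C" if "j \<in> C" for j
    by (rule neighbours_complement_subset[OF C that])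
  have 1: "(\<Prod>i\<in>insert j S. y i) = y j * (\<Prod>i\<in>S. y i)" if "j \<in> C" "S \<subseteq> ?nb j" for j S
  proof (rule prod.insert)
    show "finite S" using that nb fin finite_subset by (metis finite_Diff)
    show "j \<notin> S" using that nb by blast
  qed
  have nb': "?nb j \<subseteq> verts G" if "j \<in> C" for j using nb[OF that] by blast
  have "delta G y = (\<Sum>S\<in>{S \<in> cliques (complement_graph G). S \<subseteq> verts G - C}. \<Prod>i\<in>S. y i) +
    (\<Sum>j\<in>C. \<Sum>S\<in>{S \<in> cliques (complement_graph G). S \<subseteq> ?nb j}. \<Prod>i\<in>insert j S. y i)"
    unfolding delta_def by (rule sum_independent_split[OF fin C])
  also have "(\<Sum>j\<in>C. \<Sum>S\<in>{S \<in> cliques (complement_graph G). S \<subseteq> ?nb j}. \<Prod>i\<in>insert j S. y i)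
    = (\<Sum>j\<in>C. y j * delta_sub G (?nb j) y)"
    by (rule sum.cong[OF refl])
      (simp add: delta_sub_def delta_def independent_induced nb' sum_distrib_left 1)
  finally show ?thesis
    by (simp add: delta_sub_def delta_def independent_induced)
qed

lemma delta_complete:
  fixes y :: "'a \<Rightarrow> 'r::comm_semiring_1"
  assumes "finite A"
  shows "delta (complete_graph A) y = 1 + (\<Sum>i\<in>A. y i)"
proof -
  have "inj_on (\<lambda>i. {i}) A" by simp
  then have "(\<Sum>S\<in>(\<lambda>i. {i}) ` A. \<Prod>i\<in>S. y i) = (\<Sum>i\<in>A. y i)"
    by (subst sum.reindex) auto
  then show ?thesis
    using assms by (subst delta_def, subst independent_complete, subst sum.insert) auto
qed

lemma induced_complete: "A \<subseteq> C \<Longrightarrow> induced_subgraph (complete_graph C) A = complete_graph A"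
  by (auto simp: induced_subgraph_def complete_graph_def)


section \<open>Sums over cylinders\<close>

text \<open>
  Addition and subtraction of the indicator of \<open>S\<close> on exponent vectors. The restriction to \<open>V\<close>
  keeps the results extensional. The subtraction truncates at \<open>0\<close>, so the addition undoes
  it only for vectors that are positive on \<open>S\<close>.
\<close>
definition raise :: "'a set \<Rightarrow> 'a set \<Rightarrow> ('a \<Rightarrow> nat) \<Rightarrow> 'a \<Rightarrow> nat" where
  "raise V S n = restrict (\<lambda>i. n i + of_bool (i \<in> S)) V"

definition lower :: "'a set \<Rightarrow> 'a set \<Rightarrow> ('a \<Rightarrow> nat) \<Rightarrow> 'a \<Rightarrow> nat" where
  "lower V S n = restrict (\<lambda>i. n i - of_bool (i \<in> S)) V"

text \<open>
  If \<open>f\<close> lists the coefficients of a power series then \<open>translate V f S\<close> lists those of the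
  series multiplied by \<open>\<Prod>i\<in>S. z i\<close>.
\<close>
definition translate ::
  "'a set \<Rightarrow> (('a \<Rightarrow> nat) \<Rightarrow> real) \<Rightarrow> 'a set \<Rightarrow> ('a \<Rightarrow> nat) \<Rightarrow> real" where
  "translate V f S n = (if \<forall>i\<in>S. 0 < n i then f (lower V S n) else 0)"

text \<open>
  The event that the subvector indexed by \<open>C\<close> lies in \<open>Y\<close>. Working with arbitrary sets \<open>Y\<close>
  covers single points and whole degree levels in one go, and makes the boundary case
  \<open>m j = 0\<close> disappear, since no \<open>m - e\<^sub>j\<close> exists there and \<open>lowered C j Y\<close> is simply empty.
\<close>
definition cylinder :: "'a set \<Rightarrow> 'a set \<Rightarrow> ('a \<Rightarrow> nat) set \<Rightarrow> ('a \<Rightarrow> nat) set" where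
  "cylinder V C Y = {n \<in> V \<rightarrow>\<^sub>E UNIV. restrict n C \<in> Y}"

text \<open>
  The set \<open>Y - e\<^sub>j\<close>, where \<open>e\<^sub>j\<close> is the unit vector at \<open>j\<close>.
\<close>
definition lowered :: "'a set \<Rightarrow> 'a \<Rightarrow> ('a \<Rightarrow> nat) set \<Rightarrow> ('a \<Rightarrow> nat) set" where
  "lowered C j Y = {m \<in> C \<rightarrow>\<^sub>E UNIV. raise C {j} m \<in> Y}"

lemma lower_raise: "n \<in> V \<rightarrow>\<^sub>E UNIV \<Longrightarrow> lower V S (raise V S n) = n"
  by (rule ext) (auto simp: lower_def raise_def PiE_def extensional_def)

lemma raise_lower: "n \<in> V \<rightarrow>\<^sub>E UNIV \<Longrightarrow> \<forall>i\<in>S. 0 < n i \<Longrightarrow> raise V S (lower V S n) = n"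
  by (rule ext) (auto simp: lower_def raise_def PiE_def extensional_def)

text \<open>
  The substitution \<open>n \<mapsto> n + 1\<^sub>S\<close> is injective, and \<open>translate V f S\<close> vanishes off its range.
\<close>
lemma has_sum_translate:
  assumes SV: "S \<subseteq> V" and X: "X \<subseteq> V \<rightarrow>\<^sub>E UNIV"
    and f: "(f has_sum b) {n \<in> V \<rightarrow>\<^sub>E UNIV. raise V S n \<in> X}"
  shows "(translate V f S has_sum b) X"
proof -
  let ?A = "{n \<in> V \<rightarrow>\<^sub>E UNIV. raise V S n \<in> X}"
  have inj: "inj_on (raise V S) ?A"
    by (rule inj_onI) (metis (lifting) lower_raise mem_Collect_eq)
  have pos: "\<forall>i\<in>S. 0 < raise V S n i" for n
    using SV by (auto simp: raise_def)
  have "((translate V f S \<circ> raise V S) has_sum b) ?A"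
    by (rule has_sum_cong[THEN iffD1, OF _ f]) (simp add: translate_def pos lower_raise)
  then have *: "(translate V f S has_sum b) (raise V S ` ?A)"
    by (simp add: has_sum_reindex[OF inj])
  show ?thesis
  proof (rule has_sum_cong_neutral[THEN iffD1, OF _ _ _ *])
    fix n assume n: "n \<in> X - raise V S ` ?A"
    show "translate V f S n = 0"
    proof (cases "\<forall>i\<in>S. 0 < n i")
      case True
      have "raise V S (lower V S n) = n" by (rule raise_lower) (use n X True in auto)
      moreover have "lower V S n \<in> V \<rightarrow>\<^sub>E UNIV" by (auto simp: lower_def)
      ultimately show ?thesis using n by (metis (lifting) DiffE image_eqI mem_Collect_eq)
    qed (auto simp: translate_def)
  qed (use X in auto)
qed

lemma cylinder_raise_disjoint:
  assumes "C \<subseteq> V" "S \<inter> C = {}"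
  shows "{n \<in> V \<rightarrow>\<^sub>E UNIV. raise V S n \<in> cylinder V C Y} = cylinder V C Y"
proof -
  have "restrict (raise V S n) C = restrict n C" for n
    using assms by (intro ext) (auto simp: raise_def)
  moreover have "raise V S n \<in> V \<rightarrow>\<^sub>E UNIV" for n by (auto simp: raise_def)
  ultimately show ?thesis by (auto simp: cylinder_def)
qed

lemma cylinder_raise_insert:
  assumes "C \<subseteq> V" "j \<in> C" "S \<inter> C = {}"
  shows "{n \<in> V \<rightarrow>\<^sub>E UNIV. raise V (insert j S) n \<in> cylinder V C Y} = cylinder V C (lowered C j Y)"
proof -
  have "restrict (raise V (insert j S) n) C = raise C {j} (restrict n C)" for n
    using assms by (intro ext) (auto simp: raise_def)
  moreover have "raise V (insert j S) n \<in> V \<rightarrow>\<^sub>E UNIV" for n by (auto simp: raise_def)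
  moreover have "restrict n C \<in> C \<rightarrow>\<^sub>E UNIV" for n :: "'a \<Rightarrow> nat" by auto
  ultimately show ?thesis by (auto simp: cylinder_def lowered_def)
qed

lemma has_sum_finite_sum:
  fixes f :: "'i \<Rightarrow> 'a \<Rightarrow> real"
  assumes "finite I" "\<And>i. i \<in> I \<Longrightarrow> (f i has_sum s i) X"
  shows "((\<lambda>n. \<Sum>i\<in>I. f i n) has_sum (\<Sum>i\<in>I. s i)) X"
  using assms by (induction I rule: finite_induct) (auto intro: has_sum_add)

text \<open>
  Multiplying a series by \<open>delta G\<close> and then summing over a cylinder. The summand of an
  independent set \<open>S\<close> sums over \<open>cylinder V C Y\<close> itself if \<open>S\<close> avoids \<open>C\<close>, and over the cylinder
  of \<open>Y - e\<^sub>j\<close> if \<open>S\<close> meets \<open>C\<close> in \<open>j\<close>. So the sums over cylinders obey a relation that only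
  sees \<open>C\<close>. The factor \<open>q\<close> carries the weight that Euler's operator gives to \<open>S\<close>.
\<close>
lemma has_sum_independent_convolution:
  assumes G: "simple_graph G" and C: "C \<in> cliques G"
    and b: "(f has_sum b) (cylinder (verts G) C Y)"
    and b': "\<And>j. j \<in> C \<Longrightarrow> (f has_sum b' j) (cylinder (verts G) C (lowered C j Y))"
  shows "((\<lambda>n. \<Sum>S\<in>cliques (complement_graph G).
      q (card (S \<inter> C)) * (\<Prod>i\<in>S. z i) * translate (verts G) f S n) has_sum
    (q 0 * delta_sub G (verts G - C) z * b +
     q 1 * (\<Sum>j\<in>C. z j * delta_sub G (neighbours (complement_graph G) j) z * b' j)))
    (cylinder (verts G) C Y)"
proof -
  let ?V = "verts G" and ?I = "cliques (complement_graph G)"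
  let ?nb = "neighbours (complement_graph G)"
  let ?X = "cylinder ?V C Y"
  let ?t = "\<lambda>S n. q (card (S \<inter> C)) * (\<Prod>i\<in>S. z i) * translate ?V f S n"
  have fin: "finite ?V" using G by (simp add: simple_graph_def)
  have CV: "C \<subseteq> ?V" using C by (simp add: cliques_def)
  have finC: "finite C" using CV fin finite_subset by blast
  have X: "?X \<subseteq> ?V \<rightarrow>\<^sub>E UNIV" by (auto simp: cylinder_def)
  have nb: "?nb j \<subseteq> ?V - C" if "j \<in> C" for j
    by (rule neighbours_complement_subset[OF C that])
  have finI: "finite {S \<in> ?I. P S}" for P
    using finite_independent[OF fin] by simp
  have 0: "((\<lambda>n. ?t S n) has_sum q 0 * (\<Prod>i\<in>S. z i) * b) ?X" if S: "S \<subseteq> ?V - C" for S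
  proof -
    have SC: "S \<inter> C = {}" using S by blast
    have "(translate ?V f S has_sum b) ?X"
      by (rule has_sum_translate) (use S X b CV SC in \<open>auto simp: cylinder_raise_disjoint\<close>)
    from has_sum_cmult_right[OF this] show ?thesis by (simp add: SC)
  qed
  have 1: "((\<lambda>n. ?t (insert j S) n) has_sum q 1 * (z j * (\<Prod>i\<in>S. z i) * b' j)) ?X"
    if j: "j \<in> C" and S: "S \<subseteq> ?nb j" for j S
  proof -
    have SC: "S \<inter> C = {}" and jS: "j \<notin> S" and finS: "finite S"
      using S nb[OF j] j fin by (auto intro: finite_subset)
    have "insert j S \<inter> C = {j}" using SC j by blast
    moreover have "(translate ?V f (insert j S) has_sum b' j) ?X"
    proof (rule has_sum_translate)
      show "insert j S \<subseteq> ?V" using S nb[OF j] j CV by blast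
      show "(f has_sum b' j) {n \<in> ?V \<rightarrow>\<^sub>E UNIV. raise ?V (insert j S) n \<in> ?X}"
        unfolding cylinder_raise_insert[OF CV j SC] by (rule b'[OF j])
    qed (rule X)
    from has_sum_cmult_right[OF this, of "q 1 * (\<Prod>i\<in>insert j S. z i)"] calculation
    show ?thesis by (simp add: jS finS mult.assoc)
  qed
  have nb': "?nb j \<subseteq> ?V" if "j \<in> C" for j using nb[OF that] by blast
  have "((\<lambda>n. (\<Sum>S\<in>{S \<in> ?I. S \<subseteq> ?V - C}. ?t S n) +
        (\<Sum>j\<in>C. \<Sum>S\<in>{S \<in> ?I. S \<subseteq> ?nb j}. ?t (insert j S) n)) has_sum
      ((\<Sum>S\<in>{S \<in> ?I. S \<subseteq> ?V - C}. q 0 * (\<Prod>i\<in>S. z i) * b) +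
        (\<Sum>j\<in>C. \<Sum>S\<in>{S \<in> ?I. S \<subseteq> ?nb j}. q 1 * (z j * (\<Prod>i\<in>S. z i) * b' j)))) ?X"
    by (intro has_sum_add has_sum_finite_sum finI finC 0 1; blast)
  also have "(\<lambda>n. (\<Sum>S\<in>{S \<in> ?I. S \<subseteq> ?V - C}. ?t S n) +
        (\<Sum>j\<in>C. \<Sum>S\<in>{S \<in> ?I. S \<subseteq> ?nb j}. ?t (insert j S) n)) = (\<lambda>n. \<Sum>S\<in>?I. ?t S n)"
    by (simp add: sum_independent_split[OF fin C])
  also have "(\<Sum>S\<in>{S \<in> ?I. S \<subseteq> ?V - C}. q 0 * (\<Prod>i\<in>S. z i) * b) +
        (\<Sum>j\<in>C. \<Sum>S\<in>{S \<in> ?I. S \<subseteq> ?nb j}. q 1 * (z j * (\<Prod>i\<in>S. z i) * b' j)) =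
      q 0 * delta_sub G (?V - C) z * b + q 1 * (\<Sum>j\<in>C. z j * delta_sub G (?nb j) z * b' j)"
    by (simp add: delta_sub_def delta_def independent_induced nb' sum_distrib_left sum_distrib_right
        mult.assoc)
  finally show ?thesis .
qed


section \<open>Products with the independence polynomials\<close>

lemma exponent_raise:
  assumes "finite V" "S \<subseteq> V" "\<forall>i\<in>S. 0 < n i"
  shows "exponent V n = exponent S (\<lambda>_. 1) + exponent V (lower V S n)"
proof (rule poly_mapping_eqI)
  have "finite S" using assms finite_subset by blast
  then show "Poly_Mapping.lookup (exponent V n) i =
      Poly_Mapping.lookup (exponent S (\<lambda>_. 1) + exponent V (lower V S n)) i" for i
    using assms by (auto simp: lookup_add lookup_exponent lower_def)
qed

lemma lookup_single_times:
  fixes p :: "('a \<Rightarrow>\<^sub>0 nat) \<Rightarrow>\<^sub>0 'b::comm_ring_1"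
  shows "Poly_Mapping.lookup (Poly_Mapping.single s c * p) t =
    (if \<exists>u. t = s + u then c * Poly_Mapping.lookup p (t - s) else 0)"
proof -
  have "Poly_Mapping.lookup (Poly_Mapping.single s c * p) t =
      (\<Sum>l. (c * (\<Sum>q. Poly_Mapping.lookup p q when t = l + q)) when l = s)"
    unfolding lookup_mult by (rule Sum_any.cong) (auto simp: lookup_single when_def)
  also have "\<dots> = c * (\<Sum>q. Poly_Mapping.lookup p q when t = s + q)"
    by simp
  also have "(\<Sum>q. Poly_Mapping.lookup p q when t = s + q) =
      (if \<exists>u. t = s + u then Poly_Mapping.lookup p (t - s) else 0)"
  proof (cases "\<exists>u. t = s + u")
    case True
    then obtain u where u: "t = s + u" by blast
    have "(\<Sum>q. Poly_Mapping.lookup p q when t = s + q) = (\<Sum>q. Poly_Mapping.lookup p q when q = u)"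
      by (rule Sum_any.cong) (auto simp: u when_def)
    then show ?thesis using u by simp
  qed (simp add: when_def)
  finally show ?thesis by simp
qed

lemma lookup_single_times_exponent:
  fixes p :: "'a real_mpoly"
  assumes V: "finite V" and S: "S \<subseteq> V"
  shows "Poly_Mapping.lookup (Poly_Mapping.single (exponent S (\<lambda>_. 1)) c * p) (exponent V n) =
    c * translate V (\<lambda>n. Poly_Mapping.lookup p (exponent V n)) S n"
proof (cases "\<forall>i\<in>S. 0 < n i")
  case True
  have "exponent V n = exponent S (\<lambda>_. 1) + exponent V (lower V S n)"
    by (rule exponent_raise) (use assms True in auto)
  then show ?thesis
    using True by (auto simp: lookup_single_times translate_def)
next
  case False
  then obtain i where i: "i \<in> S" "n i = 0" by auto
  have "finite S" using assms finite_subset by blast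
  have "exponent V n \<noteq> exponent S (\<lambda>_. 1) + u" for u
  proof
    assume "exponent V n = exponent S (\<lambda>_. 1) + u"
    then have "Poly_Mapping.lookup (exponent V n) i = Poly_Mapping.lookup (exponent S (\<lambda>_. 1) + u) i"
      by simp
    then show False
      using i S V \<open>finite S\<close> by (auto simp: lookup_add lookup_exponent)
  qed
  then show ?thesis
    using False by (auto simp: lookup_single_times translate_def)
qed

lemma delta_indet:
  assumes "finite (verts G)"
  shows "(delta G indet :: 'a real_mpoly) =
    (\<Sum>S\<in>cliques (complement_graph G). Poly_Mapping.single (exponent S (\<lambda>_. 1)) 1)"
  unfolding delta_def
proof (rule sum.cong[OF refl])
  fix S assume "S \<in> cliques (complement_graph G)"
  then have "finite S" using assms by (auto simp: independent_iff intro: finite_subset)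
  then show "(\<Prod>i\<in>S. indet i :: 'a real_mpoly) = Poly_Mapping.single (exponent S (\<lambda>_. 1)) 1"
    by (rule prod_indet)
qed

lemma Delta_indet:
  assumes "finite (verts G)"
  shows "(Delta G indet :: 'a real_mpoly) =
    (\<Sum>S\<in>cliques (complement_graph G). Poly_Mapping.single (exponent S (\<lambda>_. 1)) ((- 1) ^ card S))"
  unfolding Delta_def
proof (rule sum.cong[OF refl])
  fix S assume "S \<in> cliques (complement_graph G)"
  then have "finite S" using assms by (auto simp: independent_iff intro: finite_subset)
  then show "(- 1) ^ card S * (\<Prod>i\<in>S. indet i :: 'a real_mpoly) =
      Poly_Mapping.single (exponent S (\<lambda>_. 1)) ((- 1) ^ card S)"
    by (cases "even (card S)") (simp_all add: prod_indet single_uminus)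
qed

lemma mult_coeff_0: "finite (verts G) \<Longrightarrow> mult_coeff G 0 n = of_bool (\<forall>i\<in>verts G. n i = 0)"
proof -
  assume fin: "finite (verts G)"
  have "exponent (verts G) n = 0 \<longleftrightarrow> (\<forall>i\<in>verts G. n i = 0)"
    by (auto simp: poly_mapping_eq_iff fun_eq_iff lookup_exponent fin)
  then show ?thesis
    by (simp add: mult_coeff_def lookup_one when_def)
qed

lemma mult_coeff_Suc:
  assumes "finite (verts G)"
  shows "mult_coeff G (Suc r) n =
    (\<Sum>S\<in>cliques (complement_graph G). translate (verts G) (mult_coeff G r) S n)"
proof -
  have "S \<subseteq> verts G" if "S \<in> cliques (complement_graph G)" for S
    using that by (simp add: independent_iff)
  then show ?thesis
    by (subst mult_coeff_def, subst power_Suc, subst delta_indet[OF assms], subst sum_distrib_right,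
        subst lookup_sum)
      (auto simp only: lookup_single_times_exponent[OF assms] mult_coeff_def[abs_def] mult_1
        intro!: sum.cong)
qed


section \<open>Euler's identity for the negative power\<close>

definition partial_degree :: "'a set \<Rightarrow> ('a \<Rightarrow>\<^sub>0 nat) \<Rightarrow> real" where
  "partial_degree C t = (\<Sum>i\<in>C. real (Poly_Mapping.lookup t i))"

text \<open>
  Euler's operator \<open>\<Sum>i\<in>C. z\<^sub>i \<partial>/\<partial>z\<^sub>i\<close>.
\<close>
definition euler :: "'a set \<Rightarrow> 'a real_mpoly \<Rightarrow> 'a real_mpoly" where
  "euler C p = Poly_Mapping.mapp (\<lambda>t c. partial_degree C t * c) p"

lemma lookup_euler:
  "Poly_Mapping.lookup (euler C p) t = partial_degree C t * Poly_Mapping.lookup p t"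
  by (simp add: euler_def lookup_mapp when_def in_keys_iff)

lemma partial_degree_add: "partial_degree C (s + t) = partial_degree C s + partial_degree C t"
  by (simp add: partial_degree_def lookup_add sum.distrib)

lemma euler_add: "euler C (p + q) = euler C p + euler C q"
  by (rule poly_mapping_eqI) (simp add: lookup_euler lookup_add algebra_simps)

lemma euler_sum: "euler C (\<Sum>i\<in>I. p i) = (\<Sum>i\<in>I. euler C (p i))"
  by (rule poly_mapping_eqI) (simp add: lookup_euler lookup_sum sum_distrib_left)

lemma euler_single:
  "euler C (Poly_Mapping.single t c) = Poly_Mapping.single t (partial_degree C t * c)"
  by (rule poly_mapping_eqI) (simp add: lookup_euler lookup_single when_def)

lemma euler_const: "euler C (Poly_Mapping.single 0 c) = 0"
  by (simp add: euler_single partial_degree_def)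

lemma poly_mapping_sum_single:
  "(\<Sum>t\<in>Poly_Mapping.keys p. Poly_Mapping.single t (Poly_Mapping.lookup p t)) = p"
  by (rule poly_mapping_eqI) (auto simp: lookup_sum lookup_single when_def in_keys_iff)

text \<open>
  Both sides are bilinear, so it suffices that degrees of monomials add up.
\<close>
lemma euler_mult: "euler C (p * q) = euler C p * q + p * euler C q"
proof -
  have single: "euler C (Poly_Mapping.single s c * q) =
      euler C (Poly_Mapping.single s c) * q + Poly_Mapping.single s c * euler C q" for s c
  proof (rule poly_mapping_eqI)
    fix t
    show "Poly_Mapping.lookup (euler C (Poly_Mapping.single s c * q)) t =
      Poly_Mapping.lookup (euler C (Poly_Mapping.single s c) * q + Poly_Mapping.single s c * euler C q) t"
      by (simp add: lookup_euler euler_single lookup_add lookup_single_times)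
        (auto simp: partial_degree_add algebra_simps)
  qed
  have "euler C ((\<Sum>t\<in>K. Poly_Mapping.single t (c t)) * q) =
      euler C (\<Sum>t\<in>K. Poly_Mapping.single t (c t)) * q + (\<Sum>t\<in>K. Poly_Mapping.single t (c t)) * euler C q"
    for K c
    by (simp add: sum_distrib_right euler_sum single sum.distrib)
  from this[where K = "Poly_Mapping.keys p" and c = "Poly_Mapping.lookup p"] show ?thesis
    by (simp add: poly_mapping_sum_single)
qed

lemma euler_power: "euler C (p ^ Suc k) = of_nat (Suc k) * (p ^ k * euler C p)"
proof (induction k)
  case (Suc k)
  have "euler C (p ^ Suc (Suc k)) = euler C p * p ^ Suc k + p * (of_nat (Suc k) * (p ^ k * euler C p))"
    by (subst power_Suc, subst euler_mult) (simp only: Suc.IH)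
  then show ?case by (simp add: algebra_simps)
qed simp

text \<open>
  A truncation of \<open>(1 + u)\<^sup>-\<^sup>r\<close>. Taken at \<open>u = Delta G indet - 1\<close>, it has the right coefficients
  up to total degree \<open>K\<close>.
\<close>
definition binomial_partial_sum :: "real \<Rightarrow> 'a real_mpoly \<Rightarrow> nat \<Rightarrow> 'a real_mpoly" where
  "binomial_partial_sum r u K = (\<Sum>k\<le>K. Poly_Mapping.single 0 (- r gchoose k) * u ^ k)"

text \<open>
  The series \<open>A = (1 + u)\<^sup>-\<^sup>r\<close> satisfies \<open>(1 + u) \<cdot> E A + r \<cdot> E u \<cdot> A = 0\<close> for every derivation
  \<open>E\<close>. For the truncation the coefficients telescope and leave one term containing \<open>u ^ K\<close>.
\<close>
lemma binomial_partial_sum_ode: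
  "(1 + u) * euler C (binomial_partial_sum r u K) +
     Poly_Mapping.single 0 r * euler C u * binomial_partial_sum r u K =
   Poly_Mapping.single 0 ((r + of_nat K) * (- r gchoose K)) * (u ^ K * euler C u)"
proof (induction K)
  case 0
  have "euler C 1 = 0"
    using euler_const[of C 1] by simp
  then show ?case by (simp add: binomial_partial_sum_def)
next
  case (Suc K)
  let ?A = "binomial_partial_sum r u" and ?R = "Poly_Mapping.single 0 r :: 'a real_mpoly"
  let ?c = "Poly_Mapping.single 0 (- r gchoose Suc K) :: 'a real_mpoly"
  let ?N = "of_nat (Suc K) :: 'a real_mpoly"
  let ?D = "euler C u"
  have A: "?A (Suc K) = ?A K + ?c * u ^ Suc K"
    by (simp add: binomial_partial_sum_def)
  have DA: "euler C (?A (Suc K)) = euler C (?A K) + ?c * (?N * (u ^ K * ?D))"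
    by (simp only: A euler_add euler_mult euler_power euler_const) simp
  have "(r + of_nat K) * (- r gchoose K) = - (of_nat (Suc K) * (- r gchoose Suc K))"
    using gbinomial_mult_1[of "- r" K] by (simp add: algebra_simps)
  then have rel: "Poly_Mapping.single 0 ((r + of_nat K) * (- r gchoose K)) = - (?N * ?c)"
    by (simp only: single_uminus single_of_nat[symmetric] mult_single) simp
  have rel': "Poly_Mapping.single 0 ((r + of_nat (Suc K)) * (- r gchoose Suc K)) = (?R + ?N) * ?c"
    by (simp only: single_of_nat[symmetric] mult_single single_add[symmetric]) simp
  have alg: "- (n * c) * (p * d) + (1 + v) * (c * (n * (p * d))) + s * d * (c * (v * p)) =
      (s + n) * c * (v * p * d)" for n c p d v s :: "'a real_mpoly"
    by (simp add: algebra_simps)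
  have "(1 + u) * euler C (?A (Suc K)) + ?R * ?D * ?A (Suc K) =
      ((1 + u) * euler C (?A K) + ?R * ?D * ?A K) + (1 + u) * (?c * (?N * (u ^ K * ?D)))
        + ?R * ?D * (?c * u ^ Suc K)"
    by (subst DA, subst A, simp only: distrib_left add_ac)
  also have "\<dots> = - (?N * ?c) * (u ^ K * ?D) + (1 + u) * (?c * (?N * (u ^ K * ?D)))
        + ?R * ?D * (?c * u ^ Suc K)"
    by (simp only: Suc.IH rel)
  also have "\<dots> = (?R + ?N) * ?c * (u ^ Suc K * ?D)"
    by (simp only: power_Suc alg)
  finally show ?case by (simp only: rel')
qed

lemma partial_degree_exponent:
  "finite V \<Longrightarrow> C \<subseteq> V \<Longrightarrow> partial_degree C (exponent V n) = real (\<Sum>i\<in>C. n i)"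
  by (auto simp: partial_degree_def lookup_exponent intro!: sum.cong)

text \<open>
  Every monomial of \<open>(Delta G indet - 1) ^ k\<close> has degree at least \<open>k\<close>, so that summands with \<open>k\<close>
  above the degree of \<open>n\<close> do not contribute.
\<close>
lemma lookup_binomial_partial_sum:
  fixes G :: "'a graph"
  assumes fin: "finite (verts G)" and le: "(\<Sum>i\<in>verts G. n i) \<le> K"
  shows "Poly_Mapping.lookup (binomial_partial_sum r (Delta G indet - 1) K) (exponent (verts G) n) =
    nm_coeff G r n"
proof -
  let ?l = "\<lambda>k. (- r gchoose k) *
    Poly_Mapping.lookup ((Delta G indet - 1 :: 'a real_mpoly) ^ k) (exponent (verts G) n)"
  have [simp]: "Poly_Mapping.lookup (Poly_Mapping.single 0 c * p) t = c * Poly_Mapping.lookup p t"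
    for c t and p :: "'a real_mpoly"
    by (simp add: lookup_single_times)
  have "?l k = 0" if "\<not> k \<le> (\<Sum>i\<in>verts G. n i)" for k
    using Delta_minus_1_power_degree[OF fin, of "exponent (verts G) n" k] that
    by (auto simp: lookup_exponent fin in_keys_iff)
  then have "(\<Sum>k\<le>K. ?l k) = (\<Sum>k\<le>(\<Sum>i\<in>verts G. n i). ?l k)"
    by (intro sum.mono_neutral_right) (use le in auto)
  then show ?thesis
    by (simp add: binomial_partial_sum_def lookup_sum nm_coeff_def)
qed

lemma sum_lower:
  assumes "finite V" "C \<subseteq> V" "\<forall>i\<in>S. 0 < n i"
  shows "real (\<Sum>i\<in>C. lower V S n i) = real (\<Sum>i\<in>C. n i) - real (card (S \<inter> C))"
proof -
  have finC: "finite C" using assms finite_subset by blast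
  have "(\<Sum>i\<in>C. real (lower V S n i)) = (\<Sum>i\<in>C. real (n i) - of_bool (i \<in> S))"
    by (rule sum.cong) (use assms in \<open>auto simp: lower_def of_nat_diff Suc_leI\<close>)
  also have "\<dots> = (\<Sum>i\<in>C. real (n i)) - real (card (S \<inter> C))"
    using finC by (simp add: sum_subtractf Int_commute of_bool_def sum.If_cases Int_def)
  finally show ?thesis by simp
qed

text \<open>
  The coefficientwise form of \<open>P \<cdot> E A + r \<cdot> E P \<cdot> A = 0\<close> for \<open>P = Delta G\<close> and \<open>A = P\<^sup>-\<^sup>r\<close>. This is
  a relation between finitely many coefficients, so no convergence is involved.
\<close>
lemma nm_coeff_recurrence:
  fixes G :: "'a graph"
  assumes fin: "finite (verts G)" and CV: "C \<subseteq> verts G"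
  shows "(\<Sum>S\<in>cliques (complement_graph G).
      (real (\<Sum>i\<in>C. n i) - real (card (S \<inter> C)) + r * real (card (S \<inter> C))) *
      ((- 1) ^ card S * translate (verts G) (nm_coeff G r) S n)) = 0"
proof -
  let ?V = "verts G" and ?I = "cliques (complement_graph G)"
  let ?K = "\<Sum>i\<in>?V. n i" and ?P = "Delta G indet :: 'a real_mpoly"
  let ?u = "?P - 1"
  let ?A = "binomial_partial_sum r ?u ?K"
  let ?t = "exponent ?V n"
  let ?e = "\<lambda>S. exponent S (\<lambda>_. 1) :: 'a \<Rightarrow>\<^sub>0 nat"
  have SV: "S \<subseteq> ?V" if "S \<in> ?I" for S
    using that by (simp add: independent_iff)
  have finS: "finite S" if "S \<in> ?I" for S
    using SV[OF that] fin finite_subset by blast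
  have lowP: "translate ?V (\<lambda>n. Poly_Mapping.lookup ?A (exponent ?V n)) S n =
      translate ?V (nm_coeff G r) S n" if S: "S \<in> ?I" for S
  proof (cases "\<forall>i\<in>S. 0 < n i")
    case True
    have "(\<Sum>i\<in>?V. lower ?V S n i) \<le> ?K"
      by (rule sum_mono) (simp add: lower_def)
    then show ?thesis
      using True by (simp add: translate_def lookup_binomial_partial_sum[OF fin])
  qed (simp only: translate_def if_False)
  have lowD: "translate ?V (\<lambda>n. Poly_Mapping.lookup (euler C ?A) (exponent ?V n)) S n =
      (real (\<Sum>i\<in>C. n i) - real (card (S \<inter> C))) * translate ?V (nm_coeff G r) S n"
    if S: "S \<in> ?I" for S
  proof (cases "\<forall>i\<in>S. 0 < n i")
    case True
    then show ?thesis
      using lowP[OF S] sum_lower[OF fin CV True]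
      by (simp add: translate_def lookup_euler partial_degree_exponent[OF fin CV])
  qed (simp only: translate_def if_False mult_zero_right)
  have P: "?P = (\<Sum>S\<in>?I. Poly_Mapping.single (?e S) ((- 1) ^ card S))"
    by (rule Delta_indet[OF fin])
  have deg: "partial_degree C (?e S) = real (card (S \<inter> C))" if "S \<in> ?I" for S
  proof -
    have "finite C" using CV fin finite_subset by blast
    then show ?thesis
      using finS[OF that]
      by (simp add: partial_degree_def lookup_exponent of_bool_def sum.If_cases Int_def conj_commute
          if_distrib[of real])
  qed
  have "euler C ?u = euler C ?P"
    using euler_add[of C ?u 1] euler_const[of C 1] by simp
  also have "\<dots> = (\<Sum>S\<in>?I. Poly_Mapping.single (?e S) (real (card (S \<inter> C)) * (- 1) ^ card S))"
    unfolding P euler_sum euler_single by (rule sum.cong[OF refl]) (simp only: deg)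
  finally have Du: "euler C ?u = \<dots>" .
  \<comment> \<open>The error term of the truncated equation is a multiple of \<open>E (u ^ Suc K)\<close>, all of whose monomials exceed \<open>n\<close> in degree.\<close>
  have "Poly_Mapping.lookup (?u ^ Suc ?K) ?t = 0"
  proof (rule ccontr)
    assume "Poly_Mapping.lookup (?u ^ Suc ?K) ?t \<noteq> 0"
    then have "Suc ?K \<le> (\<Sum>i\<in>?V. Poly_Mapping.lookup ?t i)"
      by (intro Delta_minus_1_power_degree[OF fin]) (simp add: in_keys_iff)
    then show False by (simp add: lookup_exponent fin)
  qed
  then have "Poly_Mapping.lookup (of_nat (Suc ?K) * (?u ^ ?K * euler C ?u)) ?t = 0"
    by (simp only: euler_power[symmetric] lookup_euler)
  then have "real (Suc ?K) * Poly_Mapping.lookup (?u ^ ?K * euler C ?u) ?t = 0"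
    by (simp only: single_of_nat[symmetric] lookup_single_times) simp
  then have "Poly_Mapping.lookup (?u ^ ?K * euler C ?u) ?t = 0"
    by (simp only: mult_eq_0_iff of_nat_eq_0_iff nat.simps) simp
  then have "Poly_Mapping.lookup ((1 + ?u) * euler C ?A + Poly_Mapping.single 0 r * euler C ?u * ?A) ?t = 0"
    by (simp only: binomial_partial_sum_ode lookup_single_times) simp
  then have "Poly_Mapping.lookup (?P * euler C ?A) ?t + r * Poly_Mapping.lookup (euler C ?u * ?A) ?t = 0"
    by (simp add: lookup_add mult.assoc lookup_single_times[of 0])
  moreover have "Poly_Mapping.lookup (?P * euler C ?A) ?t =
      (\<Sum>S\<in>?I. (-1) ^ card S * ((real (\<Sum>i\<in>C. n i) - real (card (S \<inter> C))) *
        translate ?V (nm_coeff G r) S n))"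
    by (subst P, subst sum_distrib_right, subst lookup_sum, rule sum.cong[OF refl])
      (simp only: lookup_single_times_exponent[OF fin SV] lowD)
  moreover have "Poly_Mapping.lookup (euler C ?u * ?A) ?t =
      (\<Sum>S\<in>?I. real (card (S \<inter> C)) * (- 1) ^ card S * translate ?V (nm_coeff G r) S n)"
    by (subst Du, subst sum_distrib_right, subst lookup_sum, rule sum.cong[OF refl])
      (simp only: lookup_single_times_exponent[OF fin SV] lowP)
  ultimately show ?thesis
    by (simp add: sum_distrib_left sum.distrib[symmetric] algebra_simps)
qed


section \<open>Recurrences for cylinder sums\<close>

lemma translate_monomial:
  assumes fin: "finite V" and SV: "S \<subseteq> V"
  shows "(\<Prod>i\<in>S. x i) * translate V (\<lambda>n. a n * (\<Prod>i\<in>V. x i ^ n i)) S n =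
    translate V a S n * (\<Prod>i\<in>V. x i ^ n i)"
proof (cases "\<forall>i\<in>S. 0 < n i")
  case True
  have "(\<Prod>i\<in>S. x i) = (\<Prod>i\<in>V. x i ^ of_bool (i \<in> S))"
    by (rule prod.mono_neutral_cong_left) (use fin SV in auto)
  then have "(\<Prod>i\<in>S. x i) * (\<Prod>i\<in>V. x i ^ lower V S n i) =
      (\<Prod>i\<in>V. x i ^ of_bool (i \<in> S) * x i ^ lower V S n i)"
    by (simp add: prod.distrib)
  also have "\<dots> = (\<Prod>i\<in>V. x i ^ n i)"
    by (rule prod.cong) (use True in \<open>auto simp: lower_def power_add[symmetric] simp flip: power_Suc\<close>)
  finally show ?thesis using True by (simp add: translate_def)
qed (simp only: translate_def if_False mult_zero_left mult_zero_right)

lemma Delta_sub_eq_delta_sub: "finite A \<Longrightarrow> Delta_sub G A x = delta_sub G A (\<lambda>i. - x i)"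
  by (simp add: Delta_sub_def delta_sub_def Delta_eq_delta induced_subgraph_def)

text \<open>
  Summing the recurrence of the coefficients over a cylinder on which the degree in \<open>C\<close> is
  constant. Division by \<open>Delta_sub G (verts G - C) x\<close> leaves a recurrence in which the graph
  outside \<open>C\<close> survives only through the parameters of the marginal distribution.
\<close>
lemma nm_cylinder_recurrence:
  assumes G: "simple_graph G" and C: "C \<in> cliques G"
    and D0: "Delta_sub G (verts G - C) x \<noteq> 0"
    and Y: "\<And>m. m \<in> Y \<Longrightarrow> (\<Sum>i\<in>C. m i) = k"
    and b: "((\<lambda>n. nm_coeff G r n * (\<Prod>i\<in>verts G. x i ^ n i)) has_sum b) (cylinder (verts G) C Y)"
    and b': "\<And>j. j \<in> C \<Longrightarrow> ((\<lambda>n. nm_coeff G r n * (\<Prod>i\<in>verts G. x i ^ n i)) has_sum b' j)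
      (cylinder (verts G) C (lowered C j Y))"
  shows "real k * b = (real k - 1 + r) * (\<Sum>j\<in>C. x j *
    (Delta_sub G (neighbours (complement_graph G) j) x / Delta_sub G (verts G - C) x) * b' j)"
proof -
  let ?V = "verts G" and ?I = "cliques (complement_graph G)"
  let ?nb = "neighbours (complement_graph G)"
  let ?f = "\<lambda>n. nm_coeff G r n * (\<Prod>i\<in>?V. x i ^ n i)"
  let ?q = "\<lambda>t. real k - real t + r * real t"
  have fin: "finite ?V" using G by (simp add: simple_graph_def)
  have CV: "C \<subseteq> ?V" using C by (simp add: cliques_def)
  have finnb: "finite (?nb j)" if "j \<in> C" for j
    using neighbours_complement_subset[OF C that] fin by (meson finite_Diff finite_subset)
  have "((\<lambda>n. \<Sum>S\<in>?I. ?q (card (S \<inter> C)) * (\<Prod>i\<in>S. - x i) * translate ?V ?f S n) has_sum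
    (?q 0 * delta_sub G (?V - C) (\<lambda>i. - x i) * b +
     ?q 1 * (\<Sum>j\<in>C. - x j * delta_sub G (?nb j) (\<lambda>i. - x i) * b' j))) (cylinder ?V C Y)"
    by (rule has_sum_independent_convolution[OF G C b b'])
  moreover have "(\<Sum>S\<in>?I. ?q (card (S \<inter> C)) * (\<Prod>i\<in>S. - x i) * translate ?V ?f S n) = 0"
    if n: "n \<in> cylinder ?V C Y" for n
  proof -
    have k: "(\<Sum>i\<in>C. n i) = k"
      using n Y[of "restrict n C"] by (simp add: cylinder_def)
    have "(\<Sum>S\<in>?I. ?q (card (S \<inter> C)) * (\<Prod>i\<in>S. - x i) * translate ?V ?f S n) =
      (\<Sum>S\<in>?I. ?q (card (S \<inter> C)) * ((- 1) ^ card S * translate ?V (nm_coeff G r) S n)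
         * (\<Prod>i\<in>?V. x i ^ n i))"
    proof (rule sum.cong[OF refl])
      fix S assume "S \<in> ?I"
      then have SV: "S \<subseteq> ?V" by (simp add: independent_iff)
      then have "finite S" using fin finite_subset by blast
      then show "?q (card (S \<inter> C)) * (\<Prod>i\<in>S. - x i) * translate ?V ?f S n =
          ?q (card (S \<inter> C)) * ((- 1) ^ card S * translate ?V (nm_coeff G r) S n) * (\<Prod>i\<in>?V. x i ^ n i)"
        using translate_monomial[OF fin SV, of x "nm_coeff G r" n]
        by (simp add: prod_uminus mult.assoc)
    qed
    also have "\<dots> = 0"
      using nm_coeff_recurrence[OF fin CV, of n r] unfolding sum_distrib_right[symmetric] k by simp
    finally show ?thesis .
  qed
  ultimately have "?q 0 * delta_sub G (?V - C) (\<lambda>i. - x i) * b +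
     ?q 1 * (\<Sum>j\<in>C. - x j * delta_sub G (?nb j) (\<lambda>i. - x i) * b' j) = 0"
    by (metis (no_types, lifting) has_sum_0 has_sum_unique)
  then have "real k * Delta_sub G (?V - C) x * b =
      (real k - 1 + r) * (\<Sum>j\<in>C. x j * Delta_sub G (?nb j) x * b' j)"
    using fin finnb by (simp add: Delta_sub_eq_delta_sub sum_negf cong: sum.cong)
  then have "real k * b =
      (real k - 1 + r) * ((\<Sum>j\<in>C. x j * Delta_sub G (?nb j) x * b' j) / Delta_sub G (?V - C) x)"
    using D0 by (simp add: field_simps)
  then show ?thesis by (simp add: sum_divide_distrib)
qed

definition level :: "'a set \<Rightarrow> nat \<Rightarrow> ('a \<Rightarrow> nat) set" where
  "level C k = {m \<in> C \<rightarrow>\<^sub>E UNIV. (\<Sum>i\<in>C. m i) = k}"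

lemma finite_level: "finite C \<Longrightarrow> finite (level C k)"
proof -
  assume C: "finite C"
  have "level C k \<subseteq> C \<rightarrow>\<^sub>E {..k}"
  proof
    fix m assume m: "m \<in> level C k"
    have "m i \<le> k" if "i \<in> C" for i
      using member_le_sum[OF that, of m] m C by (simp add: level_def)
    then show "m \<in> C \<rightarrow>\<^sub>E {..k}"
      using m by (auto simp: level_def PiE_iff)
  qed
  moreover have "finite (C \<rightarrow>\<^sub>E {..k})"
    by (rule finite_PiE[OF C]) simp
  ultimately show ?thesis by (rule finite_subset)
qed

lemma level_0: "finite C \<Longrightarrow> level C 0 = {restrict (\<lambda>_. 0) C}"
  by (auto simp: level_def PiE_def extensional_def fun_eq_iff)

lemma sum_raise: "finite C \<Longrightarrow> j \<in> C \<Longrightarrow> (\<Sum>i\<in>C. raise C {j} m i) = Suc (\<Sum>i\<in>C. m i)"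
  by (simp add: raise_def sum.distrib of_bool_def)

lemma lowered_level:
  assumes "finite C" "j \<in> C"
  shows "lowered C j (level C (Suc k)) = level C k" and "lowered C j (level C 0) = {}"
proof -
  have "raise C {j} m \<in> C \<rightarrow>\<^sub>E UNIV" for m by (auto simp: raise_def)
  then show "lowered C j (level C (Suc k)) = level C k" "lowered C j (level C 0) = {}"
    by (auto simp: lowered_def level_def sum_raise[OF assms])
qed

lemma lowered_mono: "Y \<subseteq> Z \<Longrightarrow> lowered C j Y \<subseteq> lowered C j Z"
  by (auto simp: lowered_def)

lemma finite_lowered: "finite Y \<Longrightarrow> finite (lowered C j Y)"
proof -
  assume "finite Y"
  moreover have "inj_on (raise C {j}) (lowered C j Y)"
    by (rule inj_onI) (metis (lifting) lower_raise lowered_def mem_Collect_eq)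
  moreover have "raise C {j} ` lowered C j Y \<subseteq> Y"
    by (auto simp: lowered_def)
  ultimately show ?thesis by (meson finite_imageD finite_subset)
qed

text \<open>
  The recurrence leads from one degree to the next and thus determines its solutions up to a
  constant factor.
\<close>
lemma level_recurrence_unique:
  fixes \<beta> \<gamma> :: "('a \<Rightarrow> nat) set \<Rightarrow> real"
  assumes C: "finite C" and empty: "\<beta> {} = 0" "\<gamma> {} = 0"
    and \<beta>: "\<And>k Y. Y \<subseteq> level C k \<Longrightarrow>
      real k * \<beta> Y = \<kappa> k * (\<Sum>j\<in>C. w j * \<beta> (lowered C j Y))"
    and \<gamma>: "\<And>k Y. Y \<subseteq> level C k \<Longrightarrow>
      real k * \<gamma> Y = \<kappa> k * (\<Sum>j\<in>C. w j * \<gamma> (lowered C j Y))"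
    and Y: "Y \<subseteq> level C k"
  shows "\<beta> Y * \<gamma> (level C 0) = \<gamma> Y * \<beta> (level C 0)"
  using Y
proof (induction k arbitrary: Y)
  case 0
  then have "Y = {} \<or> Y = level C 0" by (auto simp: level_0[OF C])
  then show ?case using empty by auto
next
  case (Suc k)
  have IH: "\<beta> (lowered C j Y) * \<gamma> (level C 0) = \<gamma> (lowered C j Y) * \<beta> (level C 0)" if "j \<in> C" for j
    using lowered_mono[OF Suc.prems, of C j] lowered_level(1)[OF C that, of k] by (intro Suc.IH) simp
  have "real (Suc k) * (\<beta> Y * \<gamma> (level C 0)) =
      \<kappa> (Suc k) * (\<Sum>j\<in>C. w j * (\<beta> (lowered C j Y) * \<gamma> (level C 0)))"
    by (simp only: mult.assoc[symmetric] \<beta>[OF Suc.prems]) (simp only: mult.assoc sum_distrib_right)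
  also have "\<dots> = \<kappa> (Suc k) * (\<Sum>j\<in>C. w j * (\<gamma> (lowered C j Y) * \<beta> (level C 0)))"
    by (simp add: IH)
  also have "\<dots> = real (Suc k) * (\<gamma> Y * \<beta> (level C 0))"
    by (simp only: mult.assoc[symmetric] \<gamma>[OF Suc.prems]) (simp only: mult.assoc sum_distrib_right)
  finally show ?case by simp
qed

text \<open>
  Summed over a whole level, the recurrence becomes scalar and is solved by the terms of the
  binomial series.
\<close>
lemma level_recurrence_binomial:
  fixes \<beta> :: "('a \<Rightarrow> nat) set \<Rightarrow> real"
  assumes C: "finite C"
    and \<beta>: "\<And>k. real k * \<beta> (level C k) = (real k - 1 + r) * (\<Sum>j\<in>C. w j * \<beta> (lowered C j (level C k)))"
  shows "\<beta> (level C k) = (- r gchoose k) * (- (\<Sum>j\<in>C. w j)) ^ k * \<beta> (level C 0)"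
proof (induction k)
  case (Suc k)
  have c: "(real k + r) * (- r gchoose k) = - (real (Suc k) * (- r gchoose Suc k))"
    using gbinomial_mult_1[of "- r" k] by (simp add: algebra_simps)
  have "real (Suc k) * \<beta> (level C (Suc k)) = (real k + r) * ((\<Sum>j\<in>C. w j) * \<beta> (level C k))"
    using \<beta>[of "Suc k"] by (simp add: lowered_level[OF C] sum_distrib_right)
  also have "\<dots> = ((real k + r) * (- r gchoose k)) * ((\<Sum>j\<in>C. w j) * (- (\<Sum>j\<in>C. w j)) ^ k * \<beta> (level C 0))"
    by (simp add: Suc.IH)
  also have "\<dots> = real (Suc k) * ((- r gchoose Suc k) * (- (\<Sum>j\<in>C. w j)) ^ Suc k * \<beta> (level C 0))"
    unfolding c by simp
  finally show ?case by (simp only: mult_cancel_left) simp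
qed simp

lemma cylinder_self: "(Y :: ('a \<Rightarrow> nat) set) \<subseteq> C \<rightarrow>\<^sub>E UNIV \<Longrightarrow> cylinder C C Y = Y"
proof -
  assume Y: "Y \<subseteq> C \<rightarrow>\<^sub>E UNIV"
  have "cylinder C C Y = {n \<in> C \<rightarrow>\<^sub>E UNIV. n \<in> Y}"
    unfolding cylinder_def by (rule Collect_cong) (simp add: PiE_restrict cong: conj_cong)
  also have "\<dots> = Y"
    using Y by blast
  finally show "cylinder C C Y = Y" .
qed

lemma simple_complete: "finite C \<Longrightarrow> simple_graph (complete_graph C)"
  by (simp add: simple_graph_def complete_graph_def)

lemma clique_complete: "C \<in> cliques (complete_graph C)"
  by (auto simp: cliques_def complete_graph_def)

lemma verts_complete: "verts (complete_graph C) = C"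
  by (simp add: complete_graph_def)

lemma neighbours_complement_complete: "neighbours (complement_graph (complete_graph C)) j = {}"
  by (auto simp: neighbours_def complement_graph_def complete_graph_def)

lemma delta_sub_empty: "delta_sub G {} y = 1"
proof -
  have "cliques (complement_graph (induced_subgraph G {})) = {{}}"
    by (simp add: independent_induced) (auto simp: independent_iff)
  then show ?thesis by (simp add: delta_sub_def delta_def)
qed

lemma Delta_sub_empty: "Delta_sub G {} x = (1::real)"
  by (simp add: Delta_sub_eq_delta_sub delta_sub_empty)

text \<open>
  The case of the graph \<open>complete_graph C\<close>, where a cylinder is just its base.
\<close>
lemma nm_complete_recurrence:
  fixes w :: "'a \<Rightarrow> real" and r :: real
  assumes C: "finite C" and Y: "Y \<subseteq> level C k"
  defines "\<gamma> \<equiv> \<lambda>Y. \<Sum>m\<in>Y. nm_coeff (complete_graph C) r m * (\<Prod>i\<in>C. w i ^ m i)"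
  shows "real k * \<gamma> Y = (real k - 1 + r) * (\<Sum>j\<in>C. w j * \<gamma> (lowered C j Y))"
proof -
  let ?f = "\<lambda>m. nm_coeff (complete_graph C) r m * (\<Prod>i\<in>verts (complete_graph C). w i ^ m i)"
  have \<gamma>: "(?f has_sum \<gamma> Z) (cylinder (verts (complete_graph C)) C Z)" if "Z \<subseteq> level C l" for Z l
  proof -
    have "finite Z" using that finite_level[OF C] finite_subset by blast
    moreover have "cylinder C C Z = Z"
      by (rule cylinder_self) (use that in \<open>auto simp: level_def\<close>)
    ultimately show ?thesis by (simp add: verts_complete \<gamma>_def)
  qed
  have "lowered C j Y \<subseteq> level C (k - 1)" if "j \<in> C" for j
    using lowered_mono[OF Y, of C j] lowered_level[OF C that] by (cases k) auto
  then have \<gamma>': "(?f has_sum \<gamma> (lowered C j Y)) (cylinder (verts (complete_graph C)) C (lowered C j Y))"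
    if "j \<in> C" for j
    using that \<gamma> by blast
  have sum: "(\<Sum>i\<in>C. m i) = k" if "m \<in> Y" for m
    using that Y by (auto simp: level_def)
  have "Delta_sub (complete_graph C) (verts (complete_graph C) - C) w \<noteq> 0"
    by (simp add: verts_complete Delta_sub_empty)
  from nm_cylinder_recurrence[OF simple_complete[OF C] clique_complete this sum \<gamma>[OF Y] \<gamma>']
  show ?thesis
    by (simp add: verts_complete Delta_sub_empty neighbours_complement_complete)
qed

lemma nm_coeff_0: "finite (verts G) \<Longrightarrow> \<forall>i\<in>verts G. n i = 0 \<Longrightarrow> nm_coeff G r n = 1"
proof -
  assume "finite (verts G)" "\<forall>i\<in>verts G. n i = 0"
  then have "exponent (verts G) n = 0"
    by (simp add: exponent_def)
  then show ?thesis
    using \<open>\<forall>i\<in>verts G. n i = 0\<close> by (simp add: nm_coeff_def lookup_one)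
qed


section \<open>Marginals of discrete random vectors\<close>

text \<open>
  Since \<open>V \<rightarrow>\<^sub>E UNIV\<close> is countable, this is countable additivity. For the
  negative multinomial distribution it also supplies the convergence of the series of
  coefficients, whose terms are probabilities up to a factor.
\<close>
lemma has_sum_measure_fibres:
  assumes M: "finite_measure M" and V: "finite V"
    and N: "N \<in> measurable M (count_space (V \<rightarrow>\<^sub>E UNIV))" and X: "X \<subseteq> V \<rightarrow>\<^sub>E (UNIV :: nat set)"
  shows "((\<lambda>n. measure M {\<omega> \<in> space M. N \<omega> = n}) has_sum measure M {\<omega> \<in> space M. N \<omega> \<in> X}) X"
proof -
  interpret finite_measure M by (rule M)
  have cX: "countable X"
    by (rule countable_subset[OF X], rule countable_PiE[OF V]) simp
  let ?e = "to_nat_on X"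
  have inj: "inj_on ?e X" by (rule inj_on_to_nat_on[OF cX])
  define A where "A = (\<lambda>k. {\<omega> \<in> space M. N \<omega> \<in> X \<and> ?e (N \<omega>) = k})"
  have sets: "{\<omega> \<in> space M. N \<omega> \<in> Z} \<in> sets M" if "Z \<subseteq> V \<rightarrow>\<^sub>E UNIV" for Z
    using measurable_sets[OF N, of Z] that by (simp add: vimage_def Int_def conj_commute)
  have "A k = {\<omega> \<in> space M. N \<omega> \<in> {n \<in> X. ?e n = k}}" for k
    by (auto simp: A_def)
  then have "A k \<in> sets M" for k
    using sets[of "{n \<in> X. ?e n = k}"] X by auto
  then have "range A \<subseteq> sets M" by blast
  moreover have "disjoint_family A" by (auto simp: A_def disjoint_family_on_def)
  ultimately have "(\<lambda>k. measure M (A k)) sums measure M (\<Union>k. A k)"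
    by (rule finite_measure_UNION)
  then have "((\<lambda>k. measure M (A k)) has_sum measure M (\<Union>k. A k)) UNIV"
    by (rule sums_nonneg_imp_has_sum) simp
  moreover have "(\<Union>k. A k) = {\<omega> \<in> space M. N \<omega> \<in> X}" by (auto simp: A_def)
  ultimately have "((\<lambda>k. measure M (A k)) has_sum measure M {\<omega> \<in> space M. N \<omega> \<in> X}) UNIV"
    by simp
  moreover have "A k = {}" if "k \<notin> ?e ` X" for k
    using that by (auto simp: A_def)
  ultimately have "((\<lambda>k. measure M (A k)) has_sum measure M {\<omega> \<in> space M. N \<omega> \<in> X}) (?e ` X)"
    by (subst has_sum_cong_neutral[where T = UNIV]) auto
  then have "((\<lambda>n. measure M (A (?e n))) has_sum measure M {\<omega> \<in> space M. N \<omega> \<in> X}) X"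
    by (simp add: has_sum_reindex[OF inj] o_def)
  moreover have "A (?e n) = {\<omega> \<in> space M. N \<omega> = n}" if "n \<in> X" for n
    using that inj by (auto simp: A_def inj_on_def)
  ultimately show ?thesis
    by (simp cong: has_sum_cong)
qed

lemma has_sum_measure_marginal:
  assumes "finite_measure M" and "finite V"
    and N: "N \<in> measurable M (count_space (V \<rightarrow>\<^sub>E UNIV))"
  shows "((\<lambda>n. measure M {\<omega> \<in> space M. N \<omega> = n}) has_sum
    measure M {\<omega> \<in> space M. restrict (N \<omega>) C \<in> Y}) (cylinder V C Y)"
proof -
  have "{\<omega> \<in> space M. N \<omega> \<in> cylinder V C Y} = {\<omega> \<in> space M. restrict (N \<omega>) C \<in> Y}"
    using measurable_space[OF N] by (auto simp: cylinder_def)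
  then show ?thesis
    using has_sum_measure_fibres[OF assms, of "cylinder V C Y"] by (auto simp: cylinder_def)
qed

lemma measurable_marginal:
  assumes "N \<in> measurable M (count_space (V \<rightarrow>\<^sub>E UNIV))"
  shows "(\<lambda>\<omega>. restrict (N \<omega>) C) \<in> measurable M (count_space (C \<rightarrow>\<^sub>E UNIV))"
  by (rule measurable_compose[OF assms]) auto


section \<open>The negative multinomial marginal\<close>

lemma marginal_weights_sum:
  fixes y :: "'a \<Rightarrow> real"
  assumes G: "simple_graph G" and C: "C \<in> cliques G" and D0: "delta_sub G (verts G - C) y \<noteq> 0"
  shows "delta G y = delta_sub G (verts G - C) y *
    (1 + (\<Sum>j\<in>C. y j * (delta_sub G (neighbours (complement_graph G) j) y / delta_sub G (verts G - C) y)))"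
  using D0 by (simp add: delta_clique_split[OF G C] distrib_left sum_distrib_left)

lemma Delta_marginal_weights_sum:
  fixes x :: "'a \<Rightarrow> real"
  assumes G: "simple_graph G" and C: "C \<in> cliques G" and D0: "Delta_sub G (verts G - C) x \<noteq> 0"
  shows "Delta G x = Delta_sub G (verts G - C) x *
    (1 - (\<Sum>j\<in>C. x j * (Delta_sub G (neighbours (complement_graph G) j) x / Delta_sub G (verts G - C) x)))"
proof -
  have fin: "finite (verts G)" using G by (simp add: simple_graph_def)
  then have "finite (neighbours (complement_graph G) j)" if "j \<in> C" for j
    using neighbours_complement_subset[OF C that] by (meson finite_Diff finite_subset)
  then show ?thesis
    using marginal_weights_sum[OF G C, of "\<lambda>i. - x i"] D0 fin
    by (simp add: Delta_eq_delta Delta_sub_eq_delta_sub sum_negf cong: sum.cong)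
qed

lemma Delta_complete: "finite A \<Longrightarrow> Delta (complete_graph A) x = (1::real) - (\<Sum>i\<in>A. x i)"
  by (simp add: Delta_eq_delta verts_complete delta_complete sum_negf)

text \<open>
  The probabilities of the events \<open>restrict (N \<omega>) C \<in> Y\<close> satisfy the recurrence of the complete
  graph, so they are a multiple of the negative multinomial weights. The multiple is found
  from the total mass: the binomial series gives \<open>(1 - W)\<^sup>-\<^sup>r\<close> times the probability of the
  origin, where \<open>W\<close> is the sum of the new parameters.
\<close>
lemma nm_marginal:
  fixes G :: "'a graph"
  assumes M: "prob_space M" and G: "simple_graph G" and C: "C \<in> cliques G"
    and nm: "nm_distributed M N G r x"
  shows "nm_distributed M (\<lambda>\<omega>. restrict (N \<omega>) C) (complete_graph C) r
    (\<lambda>i. x i * (Delta_sub G (neighbours (complement_graph G) i) x / Delta_sub G (verts G - C) x))"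
proof -
  interpret prob_space M by (rule M)
  let ?V = "verts G" and ?D = "Delta_sub G"
  let ?nb = "neighbours (complement_graph G)"
  define w where "w = (\<lambda>i. x i * (?D (?nb i) x / ?D (?V - C) x))"
  define W where "W = (\<Sum>j\<in>C. w j)"
  have r: "0 < r" and x: "x \<in> M_set G" and N: "N \<in> measurable M (count_space (?V \<rightarrow>\<^sub>E UNIV))"
    and pmf: "\<And>n. n \<in> ?V \<rightarrow>\<^sub>E UNIV \<Longrightarrow> prob {\<omega> \<in> space M. N \<omega> = n} =
      nm_coeff G r n * (\<Prod>i\<in>?V. x i ^ n i) * Delta G x powr r"
    using nm by (auto simp: nm_distributed_def)
  have fin: "finite ?V" using G by (simp add: simple_graph_def)
  have CV: "C \<subseteq> ?V" using C by (simp add: cliques_def)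
  have finC: "finite C" using CV fin finite_subset by blast
  have nbV: "?nb j \<subseteq> ?V" if "j \<in> C" for j
    using neighbours_complement_subset[OF C that] by blast
  have D_pos: "0 < ?D A x" if "A \<subseteq> ?V" for A
    using x that by (simp add: M_set_def)
  have D0: "0 < ?D (?V - C) x" by (rule D_pos) blast
  have w_pos: "0 < w j" if "j \<in> C" for j
    using that CV x D_pos[OF nbV[OF that]] D0 by (auto simp: w_def M_set_def)
  have DG: "Delta G x = ?D (?V - C) x * (1 - W)"
    unfolding W_def w_def by (rule Delta_marginal_weights_sum[OF G C]) (use D0 in simp)
  have "?D ?V x = Delta G x"
    by (simp add: Delta_sub_eq_delta_sub fin delta_sub_verts[OF G] Delta_eq_delta)
  then have DG_pos: "0 < Delta G x" using D_pos[of ?V] by simp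
  \<comment> \<open>The positivity of \<open>Delta G x\<close> is what makes the binomial series converge.\<close>
  have W: "0 \<le> W" "W < 1"
    using w_pos DG_pos D0 by (auto simp: W_def DG zero_less_mult_iff intro: sum_nonneg less_imp_le)
  define \<beta> where "\<beta> = (\<lambda>Y. prob {\<omega> \<in> space M. restrict (N \<omega>) C \<in> Y})"
  define \<gamma> where "\<gamma> = (\<lambda>Y. \<Sum>m\<in>Y. nm_coeff (complete_graph C) r m * (\<Prod>i\<in>C. w i ^ m i))"
  have sum_\<beta>: "((\<lambda>n. nm_coeff G r n * (\<Prod>i\<in>?V. x i ^ n i)) has_sum \<beta> Y / Delta G x powr r)
      (cylinder ?V C Y)" for Y
  proof -
    have "((\<lambda>n. prob {\<omega> \<in> space M. N \<omega> = n} / Delta G x powr r) has_sum \<beta> Y / Delta G x powr r)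
        (cylinder ?V C Y)"
      unfolding \<beta>_def divide_inverse
      by (intro has_sum_cmult_left has_sum_measure_marginal[OF _ fin N]) unfold_locales
    then show ?thesis
      by (rule has_sum_cong[THEN iffD1, rotated]) (use DG_pos in \<open>simp add: cylinder_def pmf\<close>)
  qed
  have rec_\<beta>: "real k * \<beta> Y = (real k - 1 + r) * (\<Sum>j\<in>C. w j * \<beta> (lowered C j Y))"
    if Y: "Y \<subseteq> level C k" for k Y
  proof -
    have "(\<Sum>i\<in>C. m i) = k" if "m \<in> Y" for m
      using that Y by (auto simp: level_def)
    from nm_cylinder_recurrence[OF G C _ this sum_\<beta> sum_\<beta>]
    have "real k * (\<beta> Y / Delta G x powr r) =
        (real k - 1 + r) * (\<Sum>j\<in>C. w j * (\<beta> (lowered C j Y) / Delta G x powr r))"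
      using D0 unfolding w_def by simp
    also have "\<dots> = (real k - 1 + r) * (\<Sum>j\<in>C. w j * \<beta> (lowered C j Y)) / Delta G x powr r"
      by (simp flip: sum_divide_distrib)
    finally show ?thesis using DG_pos by simp
  qed
  have \<gamma>0: "\<gamma> (level C 0) = 1"
    by (simp add: \<gamma>_def level_0[OF finC] nm_coeff_0 verts_complete finC)
  have \<beta>_\<gamma>: "\<beta> Y = \<gamma> Y * \<beta> (level C 0)" if "Y \<subseteq> level C k" for Y k
  proof -
    have "\<beta> {} = 0" "\<gamma> {} = 0" by (simp_all add: \<beta>_def \<gamma>_def)
    moreover have "real k * \<gamma> Y = (real k - 1 + r) * (\<Sum>j\<in>C. w j * \<gamma> (lowered C j Y))"
      if "Y \<subseteq> level C k" for k Y
      unfolding \<gamma>_def by (rule nm_complete_recurrence[OF finC that])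
    ultimately have "\<beta> Y * \<gamma> (level C 0) = \<gamma> Y * \<beta> (level C 0)"
      using level_recurrence_unique[OF finC _ _ rec_\<beta> _ that] by blast
    then show ?thesis by (simp add: \<gamma>0)
  qed
  \<comment> \<open>The levels partition the sample space.\<close>
  have sums_\<beta>: "(\<lambda>k. \<beta> (level C k)) sums 1"
  proof -
    let ?A = "\<lambda>k. {\<omega> \<in> space M. restrict (N \<omega>) C \<in> level C k}"
    have "?A k \<in> sets M" for k
    proof -
      have "?A k = (\<lambda>\<omega>. restrict (N \<omega>) C) -` level C k \<inter> space M" by auto
      then show ?thesis
        using measurable_sets[OF measurable_marginal[OF N, of C], of "level C k"]
        by (auto simp: level_def)
    qed
    then have "range ?A \<subseteq> sets M" by blast
    moreover have "disjoint_family ?A" by (auto simp: level_def disjoint_family_on_def)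
    ultimately have "(\<lambda>k. prob (?A k)) sums prob (\<Union>k. ?A k)"
      by (rule finite_measure_UNION)
    moreover have "(\<Union>k. ?A k) = space M" by (auto simp: level_def)
    ultimately show ?thesis by (simp add: \<beta>_def prob_space)
  qed
  have "\<beta> (level C k) = (- r gchoose k) * (- W) ^ k * \<beta> (level C 0)" for k
    unfolding W_def by (rule level_recurrence_binomial[OF finC rec_\<beta>]) simp
  then have "(\<lambda>k. (- r gchoose k) * (- W) ^ k * \<beta> (level C 0)) sums 1"
    using sums_\<beta> by (rule sums_cong[THEN iffD1])
  moreover have "(\<lambda>k. (- r gchoose k) * (- W) ^ k) sums (1 + - W) powr (- r)"
    by (rule gen_binomial_real) (use W in simp)
  from sums_mult2[OF this, of "\<beta> (level C 0)"]
  have "(\<lambda>k. (- r gchoose k) * (- W) ^ k * \<beta> (level C 0)) sums ((1 - W) powr (- r) * \<beta> (level C 0))"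
    by simp
  ultimately have "(1 - W) powr (- r) * \<beta> (level C 0) = 1"
    using sums_unique2 by blast
  then have \<beta>0: "\<beta> (level C 0) = (1 - W) powr r"
    using W by (simp add: powr_minus field_simps)
  have DK: "Delta (complete_graph C) w = 1 - W"
    by (simp add: Delta_complete finC W_def)
  show ?thesis
    unfolding nm_distributed_def verts_complete w_def[symmetric]
  proof (intro conjI ballI)
    show "0 < r" by (rule r)
    show "w \<in> M_set (complete_graph C)"
      unfolding M_set_def verts_complete
    proof (intro CollectI conjI ballI allI impI)
      fix A assume A: "A \<subseteq> C"
      have "(\<Sum>i\<in>A. w i) \<le> W"
        unfolding W_def by (rule sum_mono2) (use A finC w_pos in \<open>auto intro: less_imp_le\<close>)
      then show "0 < Delta_sub (complete_graph C) A w"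
        using W A finC by (simp add: Delta_sub_def induced_complete Delta_complete finite_subset)
    qed (rule w_pos)
    show "(\<lambda>\<omega>. restrict (N \<omega>) C) \<in> measurable M (count_space (C \<rightarrow>\<^sub>E UNIV))"
      by (rule measurable_marginal[OF N])
    fix m :: "'a \<Rightarrow> nat" assume "m \<in> C \<rightarrow>\<^sub>E UNIV"
    then have "{m} \<subseteq> level C (\<Sum>i\<in>C. m i)" by (simp add: level_def)
    from \<beta>_\<gamma>[OF this]
    show "prob {\<omega> \<in> space M. restrict (N \<omega>) C = m} =
        nm_coeff (complete_graph C) r m * (\<Prod>i\<in>C. w i ^ m i) * Delta (complete_graph C) w powr r"
      by (simp add: \<beta>0 DK) (simp add: \<beta>_def \<gamma>_def)
  qed
qed


section \<open>The multinomial marginal\<close>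

lemma delta_pos:
  fixes y :: "'a \<Rightarrow> real"
  assumes "finite (verts G)" "\<And>i. i \<in> verts G \<Longrightarrow> 0 < y i"
  shows "0 < delta G y"
  unfolding delta_def
proof (rule sum_pos2[of _ "{}"])
  show "{} \<in> cliques (complement_graph G)" by (simp add: independent_iff)
  show "0 \<le> (\<Prod>i\<in>S. y i)" if "S \<in> cliques (complement_graph G)" for S
    using that assms(2) by (intro prod_nonneg) (auto simp: independent_iff intro: less_imp_le)
qed (auto simp: finite_independent assms(1))

lemma delta_sub_pos:
  fixes y :: "'a \<Rightarrow> real"
  assumes "finite A" "\<And>i. i \<in> A \<Longrightarrow> 0 < y i"
  shows "0 < delta_sub G A y"
  unfolding delta_sub_def
  by (rule delta_pos) (use assms in \<open>auto simp: induced_subgraph_def\<close>)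

text \<open>
  Multiplication of \<open>delta G ^ r\<close> by one more factor \<open>delta G\<close>, seen on cylinders.
\<close>
lemma mult_cylinder_Suc:
  fixes y :: "'a \<Rightarrow> real"
  assumes G: "simple_graph G" and C: "C \<in> cliques G"
    and D0: "delta_sub G (verts G - C) y \<noteq> 0"
    and b: "((\<lambda>n. mult_coeff G r n * (\<Prod>i\<in>verts G. y i ^ n i)) has_sum b) (cylinder (verts G) C Y)"
    and b': "\<And>j. j \<in> C \<Longrightarrow> ((\<lambda>n. mult_coeff G r n * (\<Prod>i\<in>verts G. y i ^ n i)) has_sum b' j)
      (cylinder (verts G) C (lowered C j Y))"
  shows "((\<lambda>n. mult_coeff G (Suc r) n * (\<Prod>i\<in>verts G. y i ^ n i)) has_sum
    delta_sub G (verts G - C) y * (b + (\<Sum>j\<in>C. y j *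
      (delta_sub G (neighbours (complement_graph G) j) y / delta_sub G (verts G - C) y) * b' j)))
    (cylinder (verts G) C Y)"
proof -
  let ?V = "verts G" and ?I = "cliques (complement_graph G)"
  let ?f = "\<lambda>n. mult_coeff G r n * (\<Prod>i\<in>?V. y i ^ n i)"
  have fin: "finite ?V" using G by (simp add: simple_graph_def)
  have SV: "S \<subseteq> ?V" if "S \<in> ?I" for S
    using that by (simp add: independent_iff)
  have "mult_coeff G (Suc r) n * (\<Prod>i\<in>?V. y i ^ n i) =
      (\<Sum>S\<in>?I. 1 * (\<Prod>i\<in>S. y i) * translate ?V ?f S n)" for n
    by (simp add: mult_coeff_Suc[OF fin] sum_distrib_right translate_monomial[OF fin SV])
  moreover have "((\<lambda>n. \<Sum>S\<in>?I. 1 * (\<Prod>i\<in>S. y i) * translate ?V ?f S n) has_sum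
      (1 * delta_sub G (?V - C) y * b +
       1 * (\<Sum>j\<in>C. y j * delta_sub G (neighbours (complement_graph G) j) y * b' j))) (cylinder ?V C Y)"
    by (rule has_sum_independent_convolution[OF G C b b', where q = "\<lambda>_. 1"])
  ultimately show ?thesis
    using D0 by (simp add: distrib_left sum_distrib_left)
qed

lemma mult_complete_Suc:
  fixes w :: "'a \<Rightarrow> real"
  assumes C: "finite C" and Y: "Y \<subseteq> C \<rightarrow>\<^sub>E UNIV" "finite Y"
  defines "\<gamma> \<equiv> \<lambda>r Y. \<Sum>m\<in>Y. mult_coeff (complete_graph C) r m * (\<Prod>i\<in>C. w i ^ m i)"
  shows "\<gamma> (Suc r) Y = \<gamma> r Y + (\<Sum>j\<in>C. w j * \<gamma> r (lowered C j Y))"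
proof -
  let ?K = "complete_graph C"
  have sum: "((\<lambda>n. mult_coeff ?K r n * (\<Prod>i\<in>verts ?K. w i ^ n i)) has_sum \<gamma> r Z) (cylinder (verts ?K) C Z)"
    if "Z \<subseteq> C \<rightarrow>\<^sub>E UNIV" "finite Z" for Z r
    using that by (simp add: verts_complete \<gamma>_def cylinder_self)
  have "(lowered C j Y) \<subseteq> C \<rightarrow>\<^sub>E UNIV" for j by (auto simp: lowered_def)
  moreover have "delta_sub ?K (verts ?K - C) w \<noteq> 0"
    by (simp add: verts_complete delta_sub_empty)
  ultimately have "((\<lambda>n. mult_coeff ?K (Suc r) n * (\<Prod>i\<in>verts ?K. w i ^ n i)) has_sum
    delta_sub ?K (verts ?K - C) w * (\<gamma> r Y + (\<Sum>j\<in>C. w j *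
      (delta_sub ?K (neighbours (complement_graph ?K) j) w / delta_sub ?K (verts ?K - C) w) * \<gamma> r (lowered C j Y))))
    (cylinder (verts ?K) C Y)"
    by (intro mult_cylinder_Suc sum simple_complete C clique_complete Y finite_lowered)
  from has_sum_unique[OF sum[OF Y, of "Suc r"] this] show ?thesis
    by (simp add: verts_complete delta_sub_empty neighbours_complement_complete)
qed

text \<open>
  Both sides change in the same way when \<open>r\<close> increases, by the previous two lemmas.
\<close>
lemma mult_cylinder_sum:
  fixes y :: "'a \<Rightarrow> real"
  assumes G: "simple_graph G" and C: "C \<in> cliques G" and D0: "delta_sub G (verts G - C) y \<noteq> 0"
    and Y: "Y \<subseteq> C \<rightarrow>\<^sub>E UNIV" "finite Y"
  defines "w \<equiv> \<lambda>i. y i * (delta_sub G (neighbours (complement_graph G) i) y / delta_sub G (verts G - C) y)"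
  shows "((\<lambda>n. mult_coeff G r n * (\<Prod>i\<in>verts G. y i ^ n i)) has_sum
    delta_sub G (verts G - C) y ^ r *
      (\<Sum>m\<in>Y. mult_coeff (complete_graph C) r m * (\<Prod>i\<in>C. w i ^ m i))) (cylinder (verts G) C Y)"
  using Y
proof (induction r arbitrary: Y)
  case 0
  let ?V = "verts G" and ?X = "cylinder (verts G) C Y"
  let ?f = "\<lambda>n. mult_coeff G 0 n * (\<Prod>i\<in>?V. y i ^ n i)"
  let ?z = "\<lambda>A. restrict (\<lambda>_. 0 :: nat) A"
  have fin: "finite ?V" using G by (simp add: simple_graph_def)
  have CV: "C \<subseteq> ?V" using C by (simp add: cliques_def)
  have finC: "finite C" using CV fin finite_subset by blast
  have z: "n = ?z A" if "n \<in> A \<rightarrow>\<^sub>E UNIV" "\<forall>i\<in>A. n i = 0" for n A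
    using that by (auto simp: PiE_iff extensional_def fun_eq_iff)
  have f: "?f n = of_bool (n = ?z ?V)" if "n \<in> ?V \<rightarrow>\<^sub>E UNIV" for n
    using z[OF that] by (cases "\<forall>i\<in>?V. n i = 0") (auto simp: mult_coeff_0 fin)
  have "(\<Sum>m\<in>Y. mult_coeff (complete_graph C) 0 m * (\<Prod>i\<in>C. w i ^ m i)) = (\<Sum>m\<in>Y. of_bool (m = ?z C))"
  proof (rule sum.cong[OF refl])
    fix m assume "m \<in> Y"
    then have "m \<in> C \<rightarrow>\<^sub>E UNIV" using "0.prems" by blast
    from z[OF this] show "mult_coeff (complete_graph C) 0 m * (\<Prod>i\<in>C. w i ^ m i) = of_bool (m = ?z C)"
      by (cases "\<forall>i\<in>C. m i = 0") (auto simp: mult_coeff_0 verts_complete finC)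
  qed
  also have "\<dots> = of_bool (?z C \<in> Y)"
    using "0.prems" by (simp add: of_bool_def)
  also have "?z C \<in> Y \<longleftrightarrow> ?z ?V \<in> ?X"
  proof -
    have "restrict (?z ?V) C = ?z C" using CV by (auto simp: fun_eq_iff)
    then show ?thesis by (simp add: cylinder_def)
  qed
  finally have "delta_sub G (?V - C) y ^ 0 * (\<Sum>m\<in>Y. mult_coeff (complete_graph C) 0 m * (\<Prod>i\<in>C. w i ^ m i)) =
      of_bool (?z ?V \<in> ?X)"
    by simp
  moreover have "(?f has_sum of_bool (?z ?V \<in> ?X)) ?X"
  proof (cases "?z ?V \<in> ?X")
    case True
    have "(?f has_sum 1) {?z ?V}"
      by (rule has_sum_finiteI) (simp_all add: mult_coeff_0 fin)
    then show ?thesis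
      using True by (subst has_sum_cong_neutral[where T = "{?z ?V}" and g = ?f]) (auto simp: f cylinder_def)
  next
    case False
    then have "?f n = 0" if "n \<in> ?X" for n
      using that by (subst f) (auto simp: cylinder_def)
    then show ?thesis using False by (simp add: has_sum_0)
  qed
  ultimately show ?case by (simp only:)
next
  case (Suc r)
  have low: "lowered C j Y \<subseteq> C \<rightarrow>\<^sub>E UNIV" "finite (lowered C j Y)" for j
    using Suc.prems by (auto simp: lowered_def intro: finite_lowered[unfolded lowered_def])
  have fin: "finite C"
    using G C by (auto simp: cliques_def simple_graph_def intro: finite_subset)
  from mult_cylinder_Suc[OF G C D0 Suc.IH[OF Suc.prems] Suc.IH[OF low]]
  show ?case
    unfolding mult_complete_Suc[OF fin Suc.prems] w_def[symmetric]
    by (simp add: sum_distrib_left distrib_left mult_ac w_def)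
qed

text \<open>
  The empty clique turns the cylinder into the whole space. This evaluates the polynomial
  \<open>delta G indet ^ r\<close> at \<open>y\<close>.
\<close>
lemma mult_total_sum:
  fixes y :: "'a \<Rightarrow> real"
  assumes G: "simple_graph G" and y: "\<And>i. i \<in> verts G \<Longrightarrow> 0 < y i"
  shows "((\<lambda>n. mult_coeff G r n * (\<Prod>i\<in>verts G. y i ^ n i)) has_sum delta G y ^ r) (verts G \<rightarrow>\<^sub>E UNIV)"
proof -
  let ?u = "\<lambda>_ :: 'a. undefined :: nat"
  have fin: "finite (verts G)" using G by (simp add: simple_graph_def)
  have "{} \<in> cliques G" by (simp add: cliques_def)
  moreover have "delta_sub G (verts G - {}) y \<noteq> 0"
    using delta_sub_pos[OF fin, of y G] y by simp
  moreover have "{?u} \<subseteq> {} \<rightarrow>\<^sub>E UNIV" by simp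
  ultimately have "((\<lambda>n. mult_coeff G r n * (\<Prod>i\<in>verts G. y i ^ n i)) has_sum
      delta_sub G (verts G - {}) y ^ r * mult_coeff (complete_graph {}) r ?u) (cylinder (verts G) {} {?u})"
    using mult_cylinder_sum[OF G, of "{}" y "{?u}" r] by simp
  moreover have "cylinder (verts G) {} {?u} = verts G \<rightarrow>\<^sub>E UNIV"
    by (auto simp: cylinder_def)
  moreover have "mult_coeff (complete_graph {}) r ?u = 1"
    by (simp add: mult_coeff_def delta_complete verts_complete exponent_def lookup_one)
  ultimately show ?thesis by (simp add: delta_sub_verts[OF G])
qed

text \<open>
  An exponent of \<open>delta G ^ r\<close> is a sum of \<open>r\<close> independent sets, each of which contributes at most
  one vertex to a clique.
\<close>
lemma mult_coeff_support:
  assumes G: "simple_graph G" and D: "D \<in> cliques G" and "mult_coeff G r n \<noteq> 0"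
  shows "(\<Sum>i\<in>D. n i) \<le> r"
  using assms(3)
proof (induction r arbitrary: n)
  have fin: "finite (verts G)" using G by (simp add: simple_graph_def)
  have DV: "D \<subseteq> verts G" using D by (simp add: cliques_def)
  {
    case 0
    then have "\<forall>i\<in>verts G. n i = 0"
      by (simp add: mult_coeff_0[OF fin] split: if_splits)
    then show ?case using DV by (simp add: subset_iff)
  next
    case (Suc r)
    then obtain S where S: "S \<in> cliques (complement_graph G)"
      and nz: "translate (verts G) (mult_coeff G r) S n \<noteq> 0"
      unfolding mult_coeff_Suc[OF fin] by (meson sum.not_neutral_contains_not_neutral)
    then have pos: "\<forall>i\<in>S. 0 < n i" and "mult_coeff G r (lower (verts G) S n) \<noteq> 0"
      by (auto simp: translate_def split: if_splits)
    then have "(\<Sum>i\<in>D. lower (verts G) S n i) \<le> r" by (intro Suc.IH)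
    moreover have "card (S \<inter> D) \<le> 1"
    proof -
      have "finite (S \<inter> D)" using DV fin by (meson finite_Int finite_subset)
      moreover have "i = j" if "i \<in> S \<inter> D" "j \<in> S \<inter> D" for i j
      proof (rule ccontr)
        assume "i \<noteq> j"
        then have "{i, j} \<in> edges G" using that D by (simp add: cliques_def)
        then show False using that S \<open>i \<noteq> j\<close> by (simp add: independent_iff)
      qed
      ultimately show ?thesis by (simp add: card_le_Suc0_iff_eq)
    qed
    moreover note sum_lower[OF fin DV pos]
    ultimately show ?case by linarith
  }
qed

lemma mult_support_coeff:
  assumes G: "simple_graph G" and n: "n \<in> verts G \<rightarrow>\<^sub>E UNIV" "mult_coeff G r n \<noteq> 0"
  shows "n \<in> mult_support G r"
proof -
  have "finite (verts G)" using G by (simp add: simple_graph_def)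
  then have fin: "finite (cliques G)"
    by (rule finite_subset[of _ "Pow (verts G)", rotated, OF finite_Pow_iff[THEN iffD2]])
      (auto simp: cliques_def)
  moreover have "cliques G \<noteq> {}" by (auto simp: cliques_def)
  ultimately have "\<exists>D\<in>cliques G. \<forall>D'\<in>cliques G. D \<subseteq> D' \<longrightarrow> D = D'"
    by (rule finite_has_maximal)
  then have "maximal_cliques G \<noteq> {}" by (auto simp: maximal_cliques_def)
  moreover have "finite (maximal_cliques G)"
    using fin by (simp add: maximal_cliques_def)
  ultimately show ?thesis
    using n mult_coeff_support[OF G] by (auto simp: mult_support_def maximal_cliques_def)
qed

text \<open>
  The weights over the support already add up to \<open>1\<close>, so that \<open>N\<close> has no mass elsewhere and the
  formula extends to all vectors. The cylinders of the marginal need this, as they leave the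
  support.
\<close>
lemma mult_pmf:
  assumes M: "prob_space M" and G: "simple_graph G" and N: "mult_distributed M N G r y"
    and n: "n \<in> verts G \<rightarrow>\<^sub>E UNIV"
  shows "measure M {\<omega> \<in> space M. N \<omega> = n} =
    mult_coeff G r n * (\<Prod>i\<in>verts G. y i ^ n i) / delta G y ^ r"
proof (cases "n \<in> mult_support G r")
  case True
  then show ?thesis using N unfolding mult_distributed_def by blast
next
  case False
  interpret prob_space M by (rule M)
  let ?V = "verts G" and ?X = "mult_support G r"
  let ?f = "\<lambda>n. mult_coeff G r n * (\<Prod>i\<in>?V. y i ^ n i)"
  have y: "\<And>i. i \<in> ?V \<Longrightarrow> 0 < y i" and NM: "N \<in> measurable M (count_space (?V \<rightarrow>\<^sub>E UNIV))"
    using N by (auto simp: mult_distributed_def)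
  have fin: "finite ?V" using G by (simp add: simple_graph_def)
  have pos: "0 < delta G y" by (rule delta_pos) (use fin y in auto)
  have X: "?X \<subseteq> ?V \<rightarrow>\<^sub>E UNIV" by (auto simp: mult_support_def)
  have "((\<lambda>n. ?f n / delta G y ^ r) has_sum delta G y ^ r / delta G y ^ r) (?V \<rightarrow>\<^sub>E UNIV)"
    unfolding divide_inverse by (rule has_sum_cmult_left[OF mult_total_sum[OF G, of y, OF y]])
  then have "((\<lambda>n. ?f n / delta G y ^ r) has_sum 1) (?V \<rightarrow>\<^sub>E UNIV)"
    using pos by simp
  then have "((\<lambda>n. prob {\<omega> \<in> space M. N \<omega> = n}) has_sum 1) ?X"
    by (rule has_sum_cong_neutral[THEN iffD1, rotated -1])
      (use X N mult_support_coeff[OF G] in \<open>auto simp: mult_distributed_def\<close>)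
  moreover have "((\<lambda>n. prob {\<omega> \<in> space M. N \<omega> = n}) has_sum prob {\<omega> \<in> space M. N \<omega> \<in> ?X}) ?X"
    by (rule has_sum_measure_fibres[OF _ fin NM X]) unfold_locales
  ultimately have 1: "prob {\<omega> \<in> space M. N \<omega> \<in> ?X} = 1"
    using has_sum_unique by blast
  have sets: "{\<omega> \<in> space M. N \<omega> \<in> Z} \<in> sets M" if "Z \<subseteq> ?V \<rightarrow>\<^sub>E UNIV" for Z
    using measurable_sets[OF NM, of Z] that by (simp add: vimage_def Int_def conj_commute)
  have "prob ({\<omega> \<in> space M. N \<omega> \<in> ?X} \<union> {\<omega> \<in> space M. N \<omega> \<in> {n}}) =
      prob {\<omega> \<in> space M. N \<omega> \<in> ?X} + prob {\<omega> \<in> space M. N \<omega> \<in> {n}}"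
    by (rule finite_measure_Union) (use sets[OF X] sets[of "{n}"] n False in auto)
  moreover have "prob ({\<omega> \<in> space M. N \<omega> \<in> ?X} \<union> {\<omega> \<in> space M. N \<omega> \<in> {n}}) \<le> 1"
    by (rule prob_le_1)
  ultimately have "prob {\<omega> \<in> space M. N \<omega> = n} = 0"
    using 1 measure_nonneg[of M "{\<omega> \<in> space M. N \<omega> = n}"] by simp
  moreover have "mult_coeff G r n = 0"
    using mult_support_coeff[OF G n] False by blast
  ultimately show ?thesis by simp
qed

text \<open>
  The cylinder sum contains \<open>delta_sub G (verts G - C) y ^ r\<close>, which cancels against the same
  factor of \<open>delta G y ^ r\<close>.
\<close>
lemma mult_marginal:
  fixes G :: "'a graph"
  assumes M: "prob_space M" and G: "simple_graph G" and C: "C \<in> cliques G"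
    and mult: "mult_distributed M N G r y"
  shows "mult_distributed M (\<lambda>\<omega>. restrict (N \<omega>) C) (complete_graph C) r
    (\<lambda>i. y i * (delta_sub G (neighbours (complement_graph G) i) y / delta_sub G (verts G - C) y))"
proof -
  interpret prob_space M by (rule M)
  let ?V = "verts G" and ?d = "delta_sub G"
  let ?nb = "neighbours (complement_graph G)"
  define w where "w = (\<lambda>i. y i * (?d (?nb i) y / ?d (?V - C) y))"
  have r: "1 \<le> r" and y: "\<And>i. i \<in> ?V \<Longrightarrow> 0 < y i"
    and N: "N \<in> measurable M (count_space (?V \<rightarrow>\<^sub>E UNIV))"
    using mult by (auto simp: mult_distributed_def)
  have fin: "finite ?V" using G by (simp add: simple_graph_def)
  have CV: "C \<subseteq> ?V" using C by (simp add: cliques_def)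
  have finC: "finite C" using CV fin finite_subset by blast
  have d_pos: "0 < ?d A y" if "A \<subseteq> ?V" for A
    by (rule delta_sub_pos) (use that y finite_subset[OF that fin] in auto)
  have d0: "0 < ?d (?V - C) y" by (rule d_pos) blast
  have w_pos: "0 < w j" if j: "j \<in> C" for j
  proof -
    have "?nb j \<subseteq> ?V" using neighbours_complement_subset[OF C j] by blast
    then show ?thesis using d_pos d0 y j CV by (auto simp: w_def)
  qed
  have "delta G y = ?d (?V - C) y * (1 + (\<Sum>j\<in>C. w j))"
    unfolding w_def by (rule marginal_weights_sum[OF G C]) (use d0 in simp)
  then have dG: "delta G y = ?d (?V - C) y * delta (complete_graph C) w"
    by (simp add: delta_complete finC)
  show ?thesis
    unfolding mult_distributed_def verts_complete w_def[symmetric]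
  proof (intro conjI ballI)
    show "(\<lambda>\<omega>. restrict (N \<omega>) C) \<in> measurable M (count_space (C \<rightarrow>\<^sub>E UNIV))"
      by (rule measurable_marginal[OF N])
    fix m assume "m \<in> mult_support (complete_graph C) r"
    then have m: "m \<in> C \<rightarrow>\<^sub>E UNIV" by (simp add: mult_support_def verts_complete)
    let ?p = "mult_coeff (complete_graph C) r m * (\<Prod>i\<in>C. w i ^ m i)"
    have "((\<lambda>n. mult_coeff G r n * (\<Prod>i\<in>?V. y i ^ n i)) has_sum ?d (?V - C) y ^ r * ?p)
        (cylinder ?V C {m})"
      using mult_cylinder_sum[OF G C, of y "{m}" r] d0 m by (simp add: w_def)
    then have "((\<lambda>n. mult_coeff G r n * (\<Prod>i\<in>?V. y i ^ n i) / delta G y ^ r) has_sum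
        ?d (?V - C) y ^ r * ?p / delta G y ^ r) (cylinder ?V C {m})"
      unfolding divide_inverse by (rule has_sum_cmult_left)
    then have "((\<lambda>n. prob {\<omega> \<in> space M. N \<omega> = n}) has_sum ?d (?V - C) y ^ r * ?p / delta G y ^ r)
        (cylinder ?V C {m})"
      by (rule has_sum_cong[THEN iffD1, rotated]) (simp add: cylinder_def mult_pmf[OF M G mult])
    moreover have "((\<lambda>n. prob {\<omega> \<in> space M. N \<omega> = n}) has_sum
        prob {\<omega> \<in> space M. restrict (N \<omega>) C \<in> {m}}) (cylinder ?V C {m})"
      by (rule has_sum_measure_marginal[OF _ fin N]) unfold_locales
    ultimately have "prob {\<omega> \<in> space M. restrict (N \<omega>) C \<in> {m}} = ?d (?V - C) y ^ r * ?p / delta G y ^ r"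
      using has_sum_unique by blast
    then show "prob {\<omega> \<in> space M. restrict (N \<omega>) C = m} = ?p / delta (complete_graph C) w ^ r"
      using d0 by (simp add: dG power_mult_distrib)
  qed (use r w_pos in auto)
qed

section \<open>Marginals on a clique\<close>

theorem theorem3p7:
  fixes M :: "'w measure" and G :: "'a graph" and C :: "'a set"
  assumes "prob_space M"
    and "simple_graph G" and "decomposable G" and "C \<in> cliques G"
  shows "(\<forall>(r::real) (x::'a \<Rightarrow> real) (N::'w \<Rightarrow> 'a \<Rightarrow> nat).
            0 < r \<longrightarrow> x \<in> M_set G \<longrightarrow> nm_distributed M N G r x \<longrightarrow>
            nm_distributed M (\<lambda>\<omega>. restrict (N \<omega>) C) (complete_graph C) r
              (\<lambda>i. x i * (Delta_sub G (neighbours (complement_graph G) i) x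
                          / Delta_sub G (verts G - C) x)))
       \<and> (\<forall>(r::nat) (y::'a \<Rightarrow> real) (N::'w \<Rightarrow> 'a \<Rightarrow> nat).
            1 \<le> r \<longrightarrow> (\<forall>i\<in>verts G. 0 < y i) \<longrightarrow> mult_distributed M N G r y \<longrightarrow>
            mult_distributed M (\<lambda>\<omega>. restrict (N \<omega>) C) (complete_graph C) r
              (\<lambda>i. y i * (delta_sub G (neighbours (complement_graph G) i) y
                          / delta_sub G (verts G - C) y)))"
  using nm_marginal[OF assms(1,2,4)] mult_marginal[OF assms(1,2,4)] by blast

end
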